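(* Let $p\ge \mathrm{e}$ be a constant. Given an input array of size $n$, the Melbourne shuffle $\mathrm{shuffle}(I,\pi,O)$ (with parameter $p$) executes $O(\sqrt n)$ operations, each exchanging a message of size $O(\sqrt n\log n)$, between a user with private memory of size $O(\sqrt n\log n)$ and a server with storage of size $O(n\log n)$. Also, the user and the server perform $O(n\log n)$ work.
   Context: Conventions. $n$ is a perfect square; rounding of $p\log n$ to an integer is ignored. Sizes are measured in number of elements (plus constant space for a key and permutation seeds); work is measured in elementary steps, with one encryption, decryption or evaluation of the permutation on one element counted as one step. Elements are equal-size pairs $(x,v)$ with distinct keys $x\in[1,n]$. An array of $n$ elements is split into $\sqrt n$ consecutive buckets of $\sqrt n$ positions. Storage model. A client (user) accesses arrays on a server through operations: getRange$(S,\mathrm{loc},\ell)$ returns the $\ell$ elements of array $S$ at positions starting at loc; putRange$(S,\mathrm{loc},a)$ writes the array $a$ into $S$ starting at loc; getRangeDist and putRangeDist do the same for several ranges in one operation. Each call is one operation (one I/O); its message size is the total number of elements transferred; the server's work for it is proportional to that number. All elements on the server are encrypted; each element read is decrypted and re-encrypted before being written back. Single pass $\mathrm{shuffle\_pass}(I,T,\rho,O)$. $I$ and $O$ have $n$ positions, $T$ has $n\cdot p\log n$ positions split into $\sqrt n$ consecutive buckets of $\sqrt n\,p\log n$ positions. Distribution phase: for each bucket $i$ of $I$ in order, the client reads the bucket, decrypts it, and for each $j$ collects the elements $(x,v)$ such that position $\rho(x)$ lies in bucket $j$ of $O$. If for some $j$ there are more than $p\log n$ such elements, the algorithm outputs fail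 and stops. Otherwise, each of these $\sqrt n$ batches is padded with dummy elements to exactly $p\log n$ elements, encrypted, and batch $j$ is written to bucket $j$ of $T$ at offset $i\cdot p\log n$, all $\sqrt n$ batches being written by a single putRangeDist. Clean-up phase: for each bucket $j$ of $T$ in order, the client reads it, decrypts it, removes dummies, sorts the remaining $\sqrt n$ elements by $\rho(x)$, re-encrypts them, and writes them as bucket $j$ of $O$. Melbourne shuffle $\mathrm{shuffle}(I,\pi,O)$. Pick a random permutation $\pi_1$; run $\mathrm{shuffle\_pass}(I,T,\pi_1,O)$; set $I\leftarrow O$; run $\mathrm{shuffle\_pass}(I,T,\pi,O)$. *)

theory Defs
  imports
    "HOL-Probability.Probability"
    "HOL-Library.Landau_Symbols"
    "HOL-Library.Monad_Syntax"
begin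

section \<open>The client-server storage model\<close>

text \<open>
  An array element in the clear is \<open>Some (x, v)\<close> for the pair with key \<open>x\<close> and value \<open>v\<close>,
  and \<open>None\<close> for a dummy; \<open>'c\<close> is the type of ciphertexts of elements. All sizes below count
  elements.
\<close>

type_synonym 'v item = "(nat \<times> 'v) option"

datatype arr = Arr_I | Arr_T | Arr_O

text \<open>
  The server holds ciphertexts only. All elements in the client's private memory are kept in
  numbered first-in-first-out buffers, of ciphertexts (\<open>cbuf\<close>) or of plaintexts (\<open>pbuf\<close>).
  \<open>nonce\<close> is a counter that provides a fresh randomizer for every encryption. The remaining
  fields only record costs: \<open>msgs\<close> contains one entry for each operation on the server, namely
  its message size, most recent first.
\<close>

record ('v, 'c) state =
  server :: "arr \<Rightarrow> 'c list"
  cbuf :: "nat \<Rightarrow> 'c list"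
  pbuf :: "nat \<Rightarrow> 'v item list"
  nonce :: nat
  msgs :: "nat list"
  user_work :: nat
  server_work :: nat
  peak_memory :: nat
  peak_storage :: nat

text \<open>
  The summand \<open>8\<close> is the constant space for the key, the seeds of the two permutations, the
  nonce counter, and the at most four elements that are in registers at any time. The sums are
  finite because only finitely many buffers are ever nonempty.
\<close>

definition memory_size :: "('v, 'c) state \<Rightarrow> nat" where
  "memory_size \<sigma> =
     (\<Sum>b | cbuf \<sigma> b \<noteq> []. length (cbuf \<sigma> b)) + (\<Sum>b | pbuf \<sigma> b \<noteq> []. length (pbuf \<sigma> b)) + 8"

definition storage_size :: "('v, 'c) state \<Rightarrow> nat" where
  "storage_size \<sigma> = length (server \<sigma> Arr_I) + length (server \<sigma> Arr_T) + length (server \<sigma> Arr_O)"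

definition observe :: "('v, 'c) state \<Rightarrow> ('v, 'c) state" where
  "observe \<sigma> = \<sigma>\<lparr>peak_memory := max (peak_memory \<sigma>) (memory_size \<sigma>),
                 peak_storage := max (peak_storage \<sigma>) (storage_size \<sigma>)\<rparr>"

section \<open>Client programs\<close>

text \<open>
  The result \<open>None\<close> means that the program has output fail and stopped; the costs incurred until
  then are kept in the state.
\<close>

type_synonym ('v, 'c, 'a) prog = "('v, 'c) state \<Rightarrow> 'a option \<times> ('v, 'c) state"

definition return :: "'a \<Rightarrow> ('v, 'c, 'a) prog" where
  "return a = (\<lambda>\<sigma>. (Some a, \<sigma>))"

definition fail :: "('v, 'c, 'a) prog" where
  "fail = (\<lambda>\<sigma>. (None, \<sigma>))"

definition bind_prog ::
  "('v, 'c, 'a) prog \<Rightarrow> ('a \<Rightarrow> ('v, 'c, 'b) prog) \<Rightarrow> ('v, 'c, 'b) prog" where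
  "bind_prog m f = (\<lambda>\<sigma>. case m \<sigma> of (None, \<sigma>') \<Rightarrow> (None, \<sigma>') | (Some a, \<sigma>') \<Rightarrow> f a \<sigma>')"

adhoc_overloading
  Monad_Syntax.bind \<rightleftharpoons> bind_prog

fun for_loop :: "nat \<Rightarrow> (nat \<Rightarrow> ('v, 'c, unit) prog) \<Rightarrow> ('v, 'c, unit) prog" where
  "for_loop 0 body = return ()"
| "for_loop (Suc k) body = do { for_loop k body; body k }"

text \<open>
  \<open>step w f\<close> performs \<open>f\<close> at the price of \<open>w\<close> elementary steps of the client. Element data is
  accessed only through the primitives below; all of them are built from \<open>step\<close>.
\<close>

definition step ::
  "nat \<Rightarrow> (('v, 'c) state \<Rightarrow> 'a \<times> ('v, 'c) state) \<Rightarrow> ('v, 'c, 'a) prog" where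
  "step w f = (\<lambda>\<sigma>. let (a, \<sigma>') = f \<sigma>
                   in (Some a, observe (\<sigma>'\<lparr>user_work := user_work \<sigma>' + w\<rparr>)))"

subsection \<open>Operations on the server\<close>

definition record_op :: "nat \<Rightarrow> ('v, 'c) state \<Rightarrow> ('v, 'c) state" where
  "record_op m \<sigma> = \<sigma>\<lparr>msgs := m # msgs \<sigma>, server_work := server_work \<sigma> + m\<rparr>"

text \<open>Reads the given ranges (location, length) of \<open>S\<close> and appends them to ciphertext buffer \<open>b\<close>.\<close>

definition getRangeDist :: "arr \<Rightarrow> (nat \<times> nat) list \<Rightarrow> nat \<Rightarrow> ('v, 'c, unit) prog" where
  "getRangeDist S rs b = (\<lambda>\<sigma>.
     let xs = concat (map (\<lambda>(loc, l). take l (drop loc (server \<sigma> S))) rs)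
     in step (length rs + length xs)
          (\<lambda>\<sigma>. ((), record_op (length xs) (\<sigma>\<lparr>cbuf := (cbuf \<sigma>)(b := cbuf \<sigma> b @ xs)\<rparr>))) \<sigma>)"

definition getRange :: "arr \<Rightarrow> nat \<Rightarrow> nat \<Rightarrow> nat \<Rightarrow> ('v, 'c, unit) prog" where
  "getRange S loc l b = getRangeDist S [(loc, l)] b"

definition write_range :: "nat \<Rightarrow> 'c list \<Rightarrow> 'c list \<Rightarrow> 'c list" where
  "write_range loc a xs = take loc xs @ a @ drop (loc + length a) xs"

text \<open>
  For each pair \<open>(loc, b)\<close> the whole content of ciphertext buffer \<open>b\<close> is written to \<open>S\<close> starting
  at \<open>loc\<close>; these buffers are empty afterwards.
\<close>

definition putRangeDist :: "arr \<Rightarrow> (nat \<times> nat) list \<Rightarrow> ('v, 'c, unit) prog" where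
  "putRangeDist S rs = (\<lambda>\<sigma>.
     let m = (\<Sum>(loc, b)\<leftarrow>rs. length (cbuf \<sigma> b))
     in step (length rs + m)
          (\<lambda>\<sigma>. ((), record_op m (\<sigma>\<lparr>
             server := (server \<sigma>)(S := fold (\<lambda>(loc, b). write_range loc (cbuf \<sigma> b)) rs (server \<sigma> S)),
             cbuf := (\<lambda>b. if b \<in> snd ` set rs then [] else cbuf \<sigma> b)\<rparr>))) \<sigma>)"

definition putRange :: "arr \<Rightarrow> nat \<Rightarrow> nat \<Rightarrow> ('v, 'c, unit) prog" where
  "putRange S loc b = putRangeDist S [(loc, b)]"

subsection \<open>Elementary steps in private memory\<close>

definition tick :: "('v, 'c, unit) prog" where
  "tick = step 1 (\<lambda>\<sigma>. ((), \<sigma>))"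

definition pop_c :: "nat \<Rightarrow> ('v, 'c, 'c) prog" where
  "pop_c b = step 1 (\<lambda>\<sigma>. (hd (cbuf \<sigma> b), \<sigma>\<lparr>cbuf := (cbuf \<sigma>)(b := tl (cbuf \<sigma> b))\<rparr>))"

definition push_c :: "nat \<Rightarrow> 'c \<Rightarrow> ('v, 'c, unit) prog" where
  "push_c b c = step 1 (\<lambda>\<sigma>. ((), \<sigma>\<lparr>cbuf := (cbuf \<sigma>)(b := cbuf \<sigma> b @ [c])\<rparr>))"

definition pop_p :: "nat \<Rightarrow> ('v, 'c, 'v item) prog" where
  "pop_p b = step 1 (\<lambda>\<sigma>. (hd (pbuf \<sigma> b), \<sigma>\<lparr>pbuf := (pbuf \<sigma>)(b := tl (pbuf \<sigma> b))\<rparr>))"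

definition peek_p :: "nat \<Rightarrow> ('v, 'c, 'v item) prog" where
  "peek_p b = step 1 (\<lambda>\<sigma>. (hd (pbuf \<sigma> b), \<sigma>))"

definition push_p :: "nat \<Rightarrow> 'v item \<Rightarrow> ('v, 'c, unit) prog" where
  "push_p b e = step 1 (\<lambda>\<sigma>. ((), \<sigma>\<lparr>pbuf := (pbuf \<sigma>)(b := pbuf \<sigma> b @ [e])\<rparr>))"

definition length_p :: "nat \<Rightarrow> ('v, 'c, nat) prog" where
  "length_p b = step 1 (\<lambda>\<sigma>. (length (pbuf \<sigma> b), \<sigma>))"

definition encrypt :: "(nat \<Rightarrow> 'v item \<Rightarrow> 'c) \<Rightarrow> 'v item \<Rightarrow> ('v, 'c, 'c) prog" where
  "encrypt enc e = step 1 (\<lambda>\<sigma>. (enc (nonce \<sigma>) e, \<sigma>\<lparr>nonce := Suc (nonce \<sigma>)\<rparr>))"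

definition decrypt :: "('c \<Rightarrow> 'v item) \<Rightarrow> 'c \<Rightarrow> ('v, 'c, 'v item) prog" where
  "decrypt dec c = step 1 (\<lambda>\<sigma>. (dec c, \<sigma>))"

definition eval_perm :: "(nat \<Rightarrow> nat) \<Rightarrow> nat \<Rightarrow> ('v, 'c, nat) prog" where
  "eval_perm \<rho> x = step 1 (\<lambda>\<sigma>. (\<rho> x, \<sigma>))"

section \<open>Sorting in private memory\<close>

definition item_key :: "'v item \<Rightarrow> nat" where
  "item_key e = fst (the e)"

definition move_p :: "nat \<Rightarrow> nat \<Rightarrow> ('v, 'c, unit) prog" where
  "move_p b b' = do { e \<leftarrow> pop_p b; push_p b' e }"

text \<open>
  Merge sort by \<open>\<rho>(x)\<close>. \<open>merge_sort \<rho> k m\<close> sorts the \<open>m\<close> elements of buffer \<open>k\<close>, with the buffers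
  \<open>2 * k + 1\<close> and \<open>2 * k + 2\<close> for the two halves and, recursively, the descendants of these in
  the heap numbering; \<open>merge \<rho> k a b\<close> merges \<open>a\<close> and \<open>b\<close> elements of the two buffers back into
  buffer \<open>k\<close>.
\<close>

fun merge :: "(nat \<Rightarrow> nat) \<Rightarrow> nat \<Rightarrow> nat \<Rightarrow> nat \<Rightarrow> ('v, 'c, unit) prog" where
  "merge \<rho> k 0 b = for_loop b (\<lambda>_. move_p (2 * k + 2) k)"
| "merge \<rho> k (Suc a) 0 = for_loop (Suc a) (\<lambda>_. move_p (2 * k + 1) k)"
| "merge \<rho> k (Suc a) (Suc b) = do {
     e \<leftarrow> peek_p (2 * k + 1);
     e' \<leftarrow> peek_p (2 * k + 2);
     y \<leftarrow> eval_perm \<rho> (item_key e);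
     y' \<leftarrow> eval_perm \<rho> (item_key e');
     if y \<le> y' then do { move_p (2 * k + 1) k; merge \<rho> k a (Suc b) }
     else do { move_p (2 * k + 2) k; merge \<rho> k (Suc a) b } }"

fun merge_sort :: "(nat \<Rightarrow> nat) \<Rightarrow> nat \<Rightarrow> nat \<Rightarrow> ('v, 'c, unit) prog" where
  "merge_sort \<rho> k m = (if m \<le> 1 then tick else do {
     tick;
     for_loop (m div 2) (\<lambda>_. move_p k (2 * k + 1));
     for_loop (m - m div 2) (\<lambda>_. move_p k (2 * k + 2));
     merge_sort \<rho> (2 * k + 1) (m div 2);
     merge_sort \<rho> (2 * k + 2) (m - m div 2);
     merge \<rho> k (m div 2) (m - m div 2) })"

declare merge_sort.simps [simp del]

section \<open>The Melbourne shuffle\<close>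

text \<open>
  Throughout, \<open>s\<close> is the square root of \<open>n\<close>, \<open>cap\<close> is the batch size \<open>p log n\<close>, keys and positions
  \<open>\<rho>(x)\<close> range over \<open>{1..n}\<close>, and locations in arrays and bucket indices start at \<open>0\<close>.
\<close>

definition batch_size :: "real \<Rightarrow> nat \<Rightarrow> nat" where
  "batch_size p n = nat \<lceil>p * ln (real n)\<rceil>"

definition distribute_bucket ::
  "(nat \<Rightarrow> 'v item \<Rightarrow> 'c) \<Rightarrow> ('c \<Rightarrow> 'v item) \<Rightarrow> nat \<Rightarrow> nat \<Rightarrow> (nat \<Rightarrow> nat) \<Rightarrow> nat \<Rightarrow> ('v, 'c, unit) prog"
where
  "distribute_bucket enc dec s cap \<rho> i = do {
     getRange Arr_I (i * s) s 0;
     for_loop s (\<lambda>_. do {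
       c \<leftarrow> pop_c 0;
       e \<leftarrow> decrypt dec c;
       y \<leftarrow> eval_perm \<rho> (item_key e);
       push_p ((y - 1) div s) e });
     for_loop s (\<lambda>j. do {
       l \<leftarrow> length_p j;
       if l > cap then fail else return () });
     for_loop s (\<lambda>j. do {
       l \<leftarrow> length_p j;
       for_loop (cap - l) (\<lambda>_. push_p j None);
       for_loop cap (\<lambda>_. do {
         e \<leftarrow> pop_p j;
         c \<leftarrow> encrypt enc e;
         push_c j c }) });
     putRangeDist Arr_T (map (\<lambda>j. (j * (s * cap) + i * cap, j)) [0..<s]) }"

definition clean_up_bucket ::
  "(nat \<Rightarrow> 'v item \<Rightarrow> 'c) \<Rightarrow> ('c \<Rightarrow> 'v item) \<Rightarrow> nat \<Rightarrow> nat \<Rightarrow> (nat \<Rightarrow> nat) \<Rightarrow> nat \<Rightarrow> ('v, 'c, unit) prog"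
where
  "clean_up_bucket enc dec s cap \<rho> j = do {
     getRange Arr_T (j * (s * cap)) (s * cap) 0;
     for_loop (s * cap) (\<lambda>_. do {
       c \<leftarrow> pop_c 0;
       e \<leftarrow> decrypt dec c;
       if e = None then return () else push_p 0 e });
     l \<leftarrow> length_p 0;
     merge_sort \<rho> 0 l;
     for_loop l (\<lambda>_. do {
       e \<leftarrow> pop_p 0;
       c \<leftarrow> encrypt enc e;
       push_c 0 c });
     putRange Arr_O (j * s) 0 }"

definition shuffle_pass ::
  "(nat \<Rightarrow> 'v item \<Rightarrow> 'c) \<Rightarrow> ('c \<Rightarrow> 'v item) \<Rightarrow> nat \<Rightarrow> nat \<Rightarrow> (nat \<Rightarrow> nat) \<Rightarrow> ('v, 'c, unit) prog"
where
  "shuffle_pass enc dec s cap \<rho> = do {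
     for_loop s (distribute_bucket enc dec s cap \<rho>);
     for_loop s (clean_up_bucket enc dec s cap \<rho>) }"

text \<open>
  The assignment of \<open>O\<close> to \<open>I\<close> between the two passes is carried out by the client, bucket by
  bucket and with re-encryption, since the server offers no copy operation.
\<close>

definition assign_I_O ::
  "(nat \<Rightarrow> 'v item \<Rightarrow> 'c) \<Rightarrow> ('c \<Rightarrow> 'v item) \<Rightarrow> nat \<Rightarrow> ('v, 'c, unit) prog" where
  "assign_I_O enc dec s = for_loop s (\<lambda>i. do {
     getRange Arr_O (i * s) s 0;
     for_loop s (\<lambda>_. do {
       c \<leftarrow> pop_c 0;
       e \<leftarrow> decrypt dec c;
       c' \<leftarrow> encrypt enc e;
       push_c 0 c' });
     putRange Arr_I (i * s) 0 })"

definition init_state :: "'c list \<Rightarrow> 'c list \<Rightarrow> 'c list \<Rightarrow> nat \<Rightarrow> ('v, 'c) state" where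
  "init_state I T Out r = observe
     \<lparr>server = (\<lambda>S. case S of Arr_I \<Rightarrow> I | Arr_T \<Rightarrow> T | Arr_O \<Rightarrow> Out),
      cbuf = (\<lambda>_. []), pbuf = (\<lambda>_. []), nonce = r,
      msgs = [], user_work = 0, server_work = 0, peak_memory = 0, peak_storage = 0\<rparr>"

text \<open>
  The result is distributed according to the random choice of \<open>\<pi>\<^sub>1\<close>; its first component is \<open>None\<close>
  if one of the passes fails.
\<close>

definition melbourne_shuffle ::
  "(nat \<Rightarrow> 'v item \<Rightarrow> 'c) \<Rightarrow> ('c \<Rightarrow> 'v item) \<Rightarrow> nat \<Rightarrow> nat \<Rightarrow> (nat \<Rightarrow> nat) \<Rightarrow> ('v, 'c) state
     \<Rightarrow> (unit option \<times> ('v, 'c) state) pmf" where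
  "melbourne_shuffle enc dec s cap \<pi> \<sigma> = do {
     \<pi>\<^sub>1 \<leftarrow> pmf_of_set {\<rho>. \<rho> permutes {1..s\<^sup>2}};
     return_pmf ((do {
       tick;
       shuffle_pass enc dec s cap \<pi>\<^sub>1;
       assign_I_O enc dec s;
       shuffle_pass enc dec s cap \<pi> } :: ('v, 'c, unit) prog) \<sigma>) }"

text \<open>\<open>I\<close> encrypts \<open>n\<close> pairs with distinct keys in \<open>{1..n}\<close>.\<close>

definition input_array :: "('c \<Rightarrow> 'v item) \<Rightarrow> nat \<Rightarrow> 'c list \<Rightarrow> bool" where
  "input_array dec n I \<longleftrightarrow>
     (\<exists>xs. map dec I = map Some xs \<and> length xs = n \<and> distinct (map fst xs) \<and> fst ` set xs \<subseteq> {1..n})"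

end

theory Submission
  imports Defs "HOL-Real_Asymp.Real_Asymp"
begin

text \<open>
  Since \<open>\<rho>\<close> is a permutation and the keys are exactly \<open>{1..n}\<close>, exactly \<open>s = sqrt n\<close> elements are
  destined for each bucket of the output. So if no batch overflows, every bucket of \<open>T\<close> holds \<open>s\<close>
  real elements; each of the \<open>2 * s\<close> rounds of a pass then costs two operations, private memory
  \<open>O(s * cap)\<close>, linear work in \<open>s * cap\<close>, and one merge sort of \<open>s\<close> elements. The multiset of
  elements is preserved, hence the second pass meets the same situation as the first. Whether the
  output is sorted is irrelevant for the costs.
\<close>

section \<open>Memory accounting\<close>

text \<open>Costs depend on contents: the overflow test, the number of elements handed to merge sort
  and the lengths of the ranges written to \<open>O\<close> all come from decrypted data. If a
  bucket of \<open>T\<close> could hold up to \<open>s * cap\<close> real elements, sorting it would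
  only give n log^2 n in total; the exact count \<open>s\<close> brings this down to n log n. So
  contents and costs are proved together, in a program logic whose assertions see the server and the
  buffers but not the counters.

  Private memory must be bounded at every step, not only between loops. The bound
  \<open>8 + s + s * cap\<close> has three sources: a move, decryption or encryption replaces one
  stored element by one; the at most \<open>s\<close> plaintexts of an input bucket wait while
  batches of \<open>cap\<close> elements are built one at a time; and during clean-up every
  ciphertext of a bucket of \<open>T\<close> becomes at most one plaintext.

  The work of the server needs no count of its own. It is the sum of the message sizes, hence at
  most the number of operations times the largest message: sqrt n times sqrt n log n.\<close>

definition mem :: "(nat \<Rightarrow> 'c list) \<Rightarrow> (nat \<Rightarrow> 'v item list) \<Rightarrow> nat" where
  "mem C D = (\<Sum>b | C b \<noteq> []. length (C b)) + (\<Sum>b | D b \<noteq> []. length (D b)) + 8"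

text \<open>Finiteness is part of the bound because a sum over an infinite set is 0: with infinitely
  many nonempty buffers, \<open>mem C D \<le> m\<close> would bound nothing, and an update could not
  be accounted for.\<close>

definition held :: "nat \<Rightarrow> (nat \<Rightarrow> 'c list) \<Rightarrow> (nat \<Rightarrow> 'v item list) \<Rightarrow> bool" where
  "held m C D \<longleftrightarrow> finite {b. C b \<noteq> []} \<and> finite {b. D b \<noteq> []} \<and> mem C D \<le> m"

definition stor :: "(arr \<Rightarrow> 'c list) \<Rightarrow> nat" where
  "stor S = length (S Arr_I) + length (S Arr_T) + length (S Arr_O)"

lemma memory_size_mem: "memory_size \<sigma> = mem (cbuf \<sigma>) (pbuf \<sigma>)"
  by (simp add: memory_size_def mem_def)

lemma storage_size_stor: "storage_size \<sigma> = stor (server \<sigma>)"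
  by (simp add: storage_size_def stor_def)

text \<open>Both sums are split at \<open>k\<close> and agree elsewhere. The old length is added on
  the left, not subtracted on the right, to stay clear of truncated subtraction.\<close>

lemma sum_length_upd:
  fixes D :: "'b \<Rightarrow> 'e list"
  assumes "finite {b. D b \<noteq> []}"
  shows "finite {b. (D(k := xs)) b \<noteq> []}" (is ?fin)
    and "(\<Sum>b | (D(k := xs)) b \<noteq> []. length ((D(k := xs)) b)) + length (D k)
         = (\<Sum>b | D b \<noteq> []. length (D b)) + length xs" (is ?sum)
proof -
  let ?A = "{b. D b \<noteq> []} - {k}"
  have A: "finite ?A" using assms by simp
  have sub: "{b. (D(k := xs)) b \<noteq> []} \<subseteq> insert k ?A" by (auto split: if_splits)
  show ?fin by (rule finite_subset[OF sub]) (use A in simp)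
  have "(\<Sum>b | (D(k := xs)) b \<noteq> []. length ((D(k := xs)) b)) = (\<Sum>b\<in>insert k ?A. length ((D(k := xs)) b))"
    by (rule sum.mono_neutral_left) (use A sub in \<open>auto split: if_splits\<close>)
  also have "\<dots> = length xs + (\<Sum>b\<in>?A. length ((D(k := xs)) b))"
    using A by (subst sum.insert) auto
  also have "(\<Sum>b\<in>?A. length ((D(k := xs)) b)) = (\<Sum>b\<in>?A. length (D b))"
    by (rule sum.cong) auto
  finally have 1: "(\<Sum>b | (D(k := xs)) b \<noteq> []. length ((D(k := xs)) b)) = length xs + (\<Sum>b\<in>?A. length (D b))" .
  have "(\<Sum>b | D b \<noteq> []. length (D b)) = (\<Sum>b\<in>insert k ?A. length (D b))"
    by (rule sum.mono_neutral_left) (use A in auto)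
  also have "\<dots> = length (D k) + (\<Sum>b\<in>?A. length (D b))" using A by (subst sum.insert) auto
  finally show ?sum using 1 by simp
qed

text \<open>\<open>m'\<close> is the old bound corrected by the change of length, again without
  subtraction. It may be smaller than \<open>m\<close>: a pop lowers the bound and so makes room for
  a later push.\<close>

lemma held_upd_c:
  assumes "held m C D" "m + length xs \<le> m' + length (C b)"
  shows "held m' (C(b := xs)) D"
  using assms sum_length_upd[of C b xs] unfolding held_def mem_def by auto

lemma held_upd_p:
  assumes "held m C D" "m + length xs \<le> m' + length (D b)"
  shows "held m' C (D(b := xs))"
  using assms sum_length_upd[of D b xs] unfolding held_def mem_def by auto

lemma held_mem: "held m C D \<Longrightarrow> mem C D \<le> m"
  by (simp add: held_def)

lemma held_mono: "held m C D \<Longrightarrow> m \<le> m' \<Longrightarrow> held m' C D"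
  by (simp add: held_def)

lemma held_clear:
  assumes "held m C D"
  shows "held m (\<lambda>b. if b \<in> B then [] else C b) D"
proof -
  have fC: "finite {b. C b \<noteq> []}" using assms by (simp add: held_def)
  have sub: "{b. (if b \<in> B then [] else C b) \<noteq> []} \<subseteq> {b. C b \<noteq> []}" by auto
  have "(\<Sum>b | (if b \<in> B then [] else C b) \<noteq> []. length (if b \<in> B then [] else C b))
      \<le> (\<Sum>b | C b \<noteq> []. length (C b))"
    by (rule order_trans[OF sum_mono[where g = "\<lambda>b. length (C b)"] sum_mono2]) (use fC in auto)
  with assms finite_subset[OF sub fC] show ?thesis by (simp add: held_def mem_def)
qed

lemma held_empty: "held 8 (\<lambda>_. []) (\<lambda>_. [])"
  by (simp add: held_def mem_def)

section \<open>A program logic with resource bounds\<close>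

text \<open>
  \<open>M\<close>, \<open>B\<close> and \<open>Sg\<close> bound the private memory, the message sizes and the storage. In \<open>wp\<close>, \<open>a\<close> and
  \<open>u\<close> bound the number of operations and the client's work; the bounds are also claimed for runs
  that fail, while the postcondition is not.
\<close>

locale budget =
  fixes M B Sg :: nat
begin

text \<open>The current buffers and arrays are bounded along with the recorded peaks, since new
  peaks are read off from them. Equating \<open>server_work\<close> with the sum of the messages
  lets \<open>wp\<close> do without a counter for it.\<close>

definition ok :: "('v, 'c) state \<Rightarrow> bool" where
  "ok \<sigma> \<longleftrightarrow> (\<forall>m\<in>set (msgs \<sigma>). m \<le> B) \<and> server_work \<sigma> = sum_list (msgs \<sigma>) \<and>
     peak_memory \<sigma> \<le> M \<and> peak_storage \<sigma> \<le> Sg \<and>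
     held M (cbuf \<sigma>) (pbuf \<sigma>) \<and> stor (server \<sigma>) \<le> Sg"

definition wp :: "('v, 'c, 'a) prog \<Rightarrow> nat \<Rightarrow> nat \<Rightarrow>
    ('a \<Rightarrow> (arr \<Rightarrow> 'c list) \<Rightarrow> (nat \<Rightarrow> 'c list) \<Rightarrow> (nat \<Rightarrow> 'v item list) \<Rightarrow> bool) \<Rightarrow>
    (arr \<Rightarrow> 'c list) \<Rightarrow> (nat \<Rightarrow> 'c list) \<Rightarrow> (nat \<Rightarrow> 'v item list) \<Rightarrow> bool" where
  "wp m a u Q S C D \<longleftrightarrow> (\<forall>\<sigma> r \<sigma>'.
     ok \<sigma> \<and> server \<sigma> = S \<and> cbuf \<sigma> = C \<and> pbuf \<sigma> = D \<and> m \<sigma> = (r, \<sigma>') \<longrightarrow>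
     ok \<sigma>' \<and> length (msgs \<sigma>') \<le> length (msgs \<sigma>) + a \<and> user_work \<sigma>' \<le> user_work \<sigma> + u \<and>
     (\<forall>x. r = Some x \<longrightarrow> Q x (server \<sigma>') (cbuf \<sigma>') (pbuf \<sigma>')))"

lemma wp_conseq:
  assumes "wp m a u Q S C D" "a \<le> a'" "u \<le> u'" "\<And>x S C D. Q x S C D \<Longrightarrow> Q' x S C D"
  shows "wp m a' u' Q' S C D"
  unfolding wp_def
proof (intro allI impI)
  fix \<sigma> r \<sigma>'
  assume "ok \<sigma> \<and> server \<sigma> = S \<and> cbuf \<sigma> = C \<and> pbuf \<sigma> = D \<and> m \<sigma> = (r, \<sigma>')"
  then have "ok \<sigma>' \<and> length (msgs \<sigma>') \<le> length (msgs \<sigma>) + a \<and> user_work \<sigma>' \<le> user_work \<sigma> + u \<and>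
     (\<forall>x. r = Some x \<longrightarrow> Q x (server \<sigma>') (cbuf \<sigma>') (pbuf \<sigma>'))"
    using assms(1) unfolding wp_def by blast
  then show "ok \<sigma>' \<and> length (msgs \<sigma>') \<le> length (msgs \<sigma>) + a' \<and> user_work \<sigma>' \<le> user_work \<sigma> + u' \<and>
     (\<forall>x. r = Some x \<longrightarrow> Q' x (server \<sigma>') (cbuf \<sigma>') (pbuf \<sigma>'))"
    using assms(2-4) by (auto intro: order_trans)
qed

lemma wp_weaken:
  assumes "wp m a u Q S C D" "a \<le> a'" "u \<le> u'"
  shows "wp m a' u' Q S C D"
  using wp_conseq assms by blast

lemma wp_post:
  assumes "wp m a u Q S C D" "\<And>x S C D. Q x S C D \<Longrightarrow> Q' x S C D"
  shows "wp m a u Q' S C D"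
  using wp_conseq assms by blast

lemma wp_return: "Q x S C D \<Longrightarrow> wp (return x) 0 0 Q S C D"
  by (auto simp: wp_def return_def)

lemma wp_fail: "wp fail 0 0 Q S C D"
  by (auto simp: wp_def fail_def)

text \<open>The triple of the continuation is the postcondition of the first program, so no
  intermediate assertion has to be named. Its budget \<open>a'\<close>, \<open>u'\<close> must be
  uniform in the result \<open>x\<close>.\<close>

lemma wp_bind:
  fixes Q :: "'b \<Rightarrow> (arr \<Rightarrow> 'c list) \<Rightarrow> (nat \<Rightarrow> 'c list) \<Rightarrow> (nat \<Rightarrow> 'v item list) \<Rightarrow> bool"
  assumes "wp m a u (\<lambda>x. wp (f x) a' u' Q) S C D"
  shows "wp (bind_prog m f) (a + a') (u + u') Q S C D"
  unfolding wp_def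
proof (intro allI impI, elim conjE)
  fix \<sigma> :: "('v, 'c) state" and r \<sigma>'
  assume 1: "ok \<sigma>" "server \<sigma> = S" "cbuf \<sigma> = C" "pbuf \<sigma> = D" and 2: "bind_prog m f \<sigma> = (r, \<sigma>')"
  obtain q \<tau> where m: "m \<sigma> = (q, \<tau>)" by fastforce
  have t: "ok \<tau>" "length (msgs \<tau>) \<le> length (msgs \<sigma>) + a" "user_work \<tau> \<le> user_work \<sigma> + u"
    "\<And>x. q = Some x \<Longrightarrow> wp (f x) a' u' Q (server \<tau>) (cbuf \<tau>) (pbuf \<tau>)"
    using assms 1 m unfolding wp_def[of m] by blast+
  show "ok \<sigma>' \<and> length (msgs \<sigma>') \<le> length (msgs \<sigma>) + (a + a') \<and>
      user_work \<sigma>' \<le> user_work \<sigma> + (u + u') \<and>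
      (\<forall>x. r = Some x \<longrightarrow> Q x (server \<sigma>') (cbuf \<sigma>') (pbuf \<sigma>'))"
  proof (cases q)
    case None
    then show ?thesis using t 2 m by (simp add: bind_prog_def)
  next
    case (Some x)
    then have "f x \<tau> = (r, \<sigma>')" using 2 m by (simp add: bind_prog_def)
    then have "ok \<sigma>' \<and> length (msgs \<sigma>') \<le> length (msgs \<tau>) + a' \<and> user_work \<sigma>' \<le> user_work \<tau> + u' \<and>
      (\<forall>x. r = Some x \<longrightarrow> Q x (server \<sigma>') (cbuf \<sigma>') (pbuf \<sigma>'))"
      using t(1) t(4)[OF Some] unfolding wp_def by blast
    then show ?thesis using t(2,3) by auto
  qed
qed

lemma wp_if:
  assumes "b \<Longrightarrow> wp m a u Q S C D" "\<not> b \<Longrightarrow> wp m' a' u' Q S C D"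
  shows "wp (if b then m else m') (max a a') (max u u') Q S C D"
  using assms by (cases b) (auto intro: wp_weaken)

lemma wp_for:
  assumes "P 0 S C D"
    and "\<And>k S C D. k < n \<Longrightarrow> P k S C D \<Longrightarrow> wp (body k) a u (\<lambda>_. P (Suc k)) S C D"
  shows "wp (for_loop n body) (n * a) (n * u) (\<lambda>_. P n) S C D"
  using assms(2)
proof (induction n)
  case 0
  then show ?case using assms(1) by (simp add: wp_return)
next
  case (Suc n)
  have 1: "wp (for_loop n body) (n * a) (n * u) (\<lambda>_. P n) S C D"
    by (rule Suc.IH) (use Suc.prems in simp)
  have "wp (for_loop (Suc n) body) (n * a + a) (n * u + u) (\<lambda>_. P (Suc n)) S C D"
    unfolding for_loop.simps
    by (rule wp_bind, rule wp_post[OF 1]) (use Suc.prems in simp)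
  then show ?case by (simp add: add.commute)
qed

text \<open>Server operations compute their price from the state before they call
  \<open>step\<close>. For fixed \<open>S\<close>, \<open>C\<close>, \<open>D\<close> this price is
  a constant, and the operation agrees with a plain \<open>step\<close> on the states
  concerned.\<close>

lemma wp_cong:
  assumes "\<And>\<sigma>. server \<sigma> = S \<Longrightarrow> cbuf \<sigma> = C \<Longrightarrow> pbuf \<sigma> = D \<Longrightarrow> m \<sigma> = m' \<sigma>"
    and "wp m' a u Q S C D"
  shows "wp m a u Q S C D"
  using assms unfolding wp_def by metis

text \<open>The only place where peaks are checked: every primitive is a \<open>step\<close>, and
  \<open>observe\<close> compares the peaks with the resulting state. \<open>ms\<close> lists the
  newly recorded messages: none for local steps, one for a server operation.\<close>

lemma wp_step:
  assumes "\<And>\<sigma> x \<sigma>'. ok \<sigma> \<Longrightarrow> server \<sigma> = S \<Longrightarrow> cbuf \<sigma> = C \<Longrightarrow> pbuf \<sigma> = D \<Longrightarrow> f \<sigma> = (x, \<sigma>') \<Longrightarrow>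
       msgs \<sigma>' = ms @ msgs \<sigma> \<and> server_work \<sigma>' = server_work \<sigma> + sum_list ms \<and>
       user_work \<sigma>' = user_work \<sigma> \<and> peak_memory \<sigma>' = peak_memory \<sigma> \<and>
       peak_storage \<sigma>' = peak_storage \<sigma> \<and> held M (cbuf \<sigma>') (pbuf \<sigma>') \<and>
       stor (server \<sigma>') \<le> Sg \<and> Q x (server \<sigma>') (cbuf \<sigma>') (pbuf \<sigma>')"
    and "\<forall>m\<in>set ms. m \<le> B" "length ms = a"
  shows "wp (step w f) a w Q S C D"
  unfolding wp_def assms(3)[symmetric]
proof (intro allI impI, elim conjE)
  fix \<sigma> r \<sigma>'
  assume 1: "ok \<sigma>" "server \<sigma> = S" "cbuf \<sigma> = C" "pbuf \<sigma> = D" and 2: "step w f \<sigma> = (r, \<sigma>')"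
  obtain x \<tau> where f: "f \<sigma> = (x, \<tau>)" by fastforce
  note t = assms(1)[OF 1 f]
  have "r = Some x" and \<sigma>': "\<sigma>' = observe (\<tau>\<lparr>user_work := user_work \<tau> + w\<rparr>)"
    using 2 f by (auto simp: step_def)
  moreover have "ok \<sigma>'"
    using t 1(1) assms(2) held_mem[of M "cbuf \<tau>" "pbuf \<tau>"]
    by (auto simp: \<sigma>' ok_def observe_def memory_size_mem storage_size_stor)
  ultimately show "ok \<sigma>' \<and> length (msgs \<sigma>') \<le> length (msgs \<sigma>) + length ms \<and>
      user_work \<sigma>' \<le> user_work \<sigma> + w \<and>
      (\<forall>y. r = Some y \<longrightarrow> Q y (server \<sigma>') (cbuf \<sigma>') (pbuf \<sigma>'))"
    using t by (auto simp: observe_def)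
qed

section \<open>Proof rules for the primitive steps\<close>

lemmas wp_step_local = wp_step[where ms = "[]", simplified]

lemma wp_tick: "Q () S C D \<Longrightarrow> wp tick 0 1 Q S C D"
  unfolding tick_def by (rule wp_step_local) (auto simp: ok_def)

lemma wp_peek_p: "Q (hd (D b)) S C D \<Longrightarrow> wp (peek_p b) 0 1 Q S C D"
  unfolding peek_p_def by (rule wp_step_local) (auto simp: ok_def)

lemma wp_length_p: "Q (length (D b)) S C D \<Longrightarrow> wp (length_p b) 0 1 Q S C D"
  unfolding length_p_def by (rule wp_step_local) (auto simp: ok_def)

lemma wp_decrypt: "Q (dec c) S C D \<Longrightarrow> wp (decrypt dec c) 0 1 Q S C D"
  unfolding decrypt_def by (rule wp_step_local) (auto simp: ok_def)

lemma wp_eval_perm: "Q (\<rho> x) S C D \<Longrightarrow> wp (eval_perm \<rho> x) 0 1 Q S C D"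
  unfolding eval_perm_def by (rule wp_step_local) (auto simp: ok_def)

text \<open>Assertions do not see the nonce, so the postcondition has to hold for every randomizer
  \<open>r\<close>.\<close>

lemma wp_encrypt: "(\<And>r. Q (enc r e) S C D) \<Longrightarrow> wp (encrypt enc e) 0 1 Q S C D"
  unfolding encrypt_def by (rule wp_step_local) (auto simp: ok_def)

lemma wp_pop_c: "Q (hd (C b)) S (C(b := tl (C b))) D \<Longrightarrow> wp (pop_c b) 0 1 Q S C D"
  unfolding pop_c_def by (rule wp_step_local) (auto simp: ok_def intro!: held_upd_c)

lemma wp_pop_p: "Q (hd (D b)) S C (D(b := tl (D b))) \<Longrightarrow> wp (pop_p b) 0 1 Q S C D"
  unfolding pop_p_def by (rule wp_step_local) (auto simp: ok_def intro!: held_upd_p)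

lemma wp_push_c:
  "held M (C(b := C b @ [c])) D \<Longrightarrow> Q () S (C(b := C b @ [c])) D \<Longrightarrow> wp (push_c b c) 0 1 Q S C D"
  unfolding push_c_def by (rule wp_step_local) (auto simp: ok_def)

lemma wp_push_p:
  "held M C (D(b := D b @ [e])) \<Longrightarrow> Q () S C (D(b := D b @ [e])) \<Longrightarrow> wp (push_p b e) 0 1 Q S C D"
  unfolding push_p_def by (rule wp_step_local) (auto simp: ok_def)

lemma wp_getRange:
  assumes "xs = take l (drop loc (S A))" "length xs \<le> B" "held M (C(b := C b @ xs)) D"
    and "Q () S (C(b := C b @ xs)) D"
  shows "wp (getRange A loc l b) 1 (1 + length xs) Q S C D"
proof (rule wp_cong)
  show "wp (step (1 + length xs)
      (\<lambda>\<sigma>. ((), record_op (length xs) (\<sigma>\<lparr>cbuf := (cbuf \<sigma>)(b := cbuf \<sigma> b @ xs)\<rparr>))))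
      1 (1 + length xs) Q S C D"
    by (rule wp_step[where ms = "[length xs]"])
       (use assms in \<open>auto simp: ok_def record_op_def\<close>)
qed (simp add: getRange_def getRangeDist_def assms(1))

lemma wp_putRangeDist:
  assumes "m = (\<Sum>(loc, b)\<leftarrow>rs. length (C b))" "m \<le> B"
    and "S' = S(A := fold (\<lambda>(loc, b). write_range loc (C b)) rs (S A))" "stor S' \<le> Sg"
    and "Q () S' (\<lambda>b. if b \<in> snd ` set rs then [] else C b) D"
  shows "wp (putRangeDist A rs) 1 (length rs + m) Q S C D"
proof (rule wp_cong)
  show "wp (step (length rs + m) (\<lambda>\<sigma>. ((), record_op m (\<sigma>\<lparr>
             server := (server \<sigma>)(A := fold (\<lambda>(loc, b). write_range loc (cbuf \<sigma> b)) rs (server \<sigma> A)),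
             cbuf := (\<lambda>b. if b \<in> snd ` set rs then [] else cbuf \<sigma> b)\<rparr>))))
      1 (length rs + m) Q S C D"
    by (rule wp_step[where ms = "[m]"])
       (use assms in \<open>auto simp: ok_def record_op_def intro!: held_clear\<close>)
qed (simp add: putRangeDist_def assms(1) Let_def)

lemma wp_putRange:
  assumes "length (C b) \<le> B"
    and "S' = S(A := write_range loc (C b) (S A))" "stor S' \<le> Sg"
    and "Q () S' (C(b := [])) D"
  shows "wp (putRange A loc b) 1 (1 + length (C b)) Q S C D"
proof -
  have eq: "(\<lambda>b'. if b' \<in> snd ` set [(loc, b)] then [] else C b') = C(b := [])" by auto
  have "wp (putRangeDist A [(loc, b)]) 1 (length [(loc, b)] + length (C b)) Q S C D"
    by (rule wp_putRangeDist[OF _ assms(1) _ assms(3)]) (use assms eq in simp_all)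
  then show ?thesis by (simp add: putRange_def)
qed

section \<open>Merge sort\<close>

text \<open>The pop lowers the memory bound to \<open>m - 1\<close> and the push restores it;
  \<open>m \<ge> 1\<close> by the constant 8 in \<open>mem\<close>. So moves, and with them the
  whole sort, stay within whatever bound \<open>m\<close> holds at the start. The last premise
  offers \<open>held\<close> for the new buffers as an assumption, which spares its proof at each
  use.\<close>

lemma wp_move_p:
  assumes "held m C D" "m \<le> M" "D b = e # xs" "b \<noteq> b'"
    and "held m C (D(b := xs, b' := D b' @ [e])) \<Longrightarrow> Q () S C (D(b := xs, b' := D b' @ [e]))"
  shows "wp (move_p b b') 0 2 Q S C D"
proof -
  have m: "m \<ge> 1" using assms(1) by (simp add: held_def mem_def)
  have "held (m - 1) C (D(b := xs))"
    using m assms(3) by (intro held_upd_p[OF assms(1)]) simp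
  then have h: "held m C (D(b := xs, b' := D b' @ [e]))"
    by (rule held_upd_p) (use m assms(4) in simp)
  have "wp (move_p b b') (0 + 0) (1 + 1) Q S C D"
    unfolding move_p_def
    by (rule wp_bind, rule wp_pop_p, rule wp_push_p)
       (use assms(3-5) h held_mono[OF h assms(2)] in simp_all)
  then show ?thesis by (simp add: numeral_2_eq_2)
qed

lemma wp_move_loop:
  assumes "held m C D" "m \<le> M" "D b = xs @ ys" "b \<noteq> b'" "length xs = n"
  shows "wp (for_loop n (\<lambda>_. move_p b b')) 0 (2 * n)
    (\<lambda>_ S' C' D'. S' = S \<and> C' = C \<and> held m C D' \<and> D' = D(b := ys, b' := D b' @ xs)) S C D"
proof -
  let ?P = "\<lambda>k S' C' D'. S' = S \<and> C' = C \<and> held m C D' \<and> D' = D(b := drop k xs @ ys, b' := D b' @ take k xs)"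
  have "wp (for_loop n (\<lambda>_. move_p b b')) (n * 0) (n * 2) (\<lambda>_. ?P n) S C D"
  proof (rule wp_for)
    show "?P 0 S C D" using assms by (auto simp: fun_upd_idem)
  next
    fix k S' C' D'
    assume k: "k < n" and P: "?P k S' C' D'"
    then have d: "drop k xs = xs ! k # drop (Suc k) xs" "take (Suc k) xs = take k xs @ [xs ! k]"
      using assms(5) by (auto simp: Cons_nth_drop_Suc take_Suc_conv_app_nth)
    show "wp (move_p b b') 0 2 (\<lambda>_. ?P (Suc k)) S' C' D'"
      by (rule wp_move_p[of m _ _ _ "xs ! k" "drop (Suc k) xs @ ys"])
         (use P assms d in \<open>auto simp: fun_upd_twist\<close>)
  qed
  then show ?thesis using assms(5) by (simp add: mult.commute)
qed

text \<open>Each comparison costs 2 peeks, 2 evaluations and a move of 2 steps, that is 6 per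
  element, and uses up an element of one of the two halves; hence the induction on
  \<open>a + b\<close>. The order of \<open>zs\<close> is left open.\<close>

lemma wp_merge:
  assumes "held m C D" "m \<le> M" "D (2 * k + 1) = xs" "D (2 * k + 2) = ys"
    and "length xs = a" "length ys = b"
  shows "wp (merge \<rho> k a b) 0 (6 * (a + b))
    (\<lambda>_ S' C' D'. S' = S \<and> C' = C \<and> held m C D' \<and>
       (\<exists>zs. mset zs = mset xs + mset ys \<and> D' = D(2 * k + 1 := [], 2 * k + 2 := [], k := D k @ zs))) S C D"
  using assms
proof (induction "a + b" arbitrary: a b D xs ys rule: less_induct)
  case less
  let ?Q = "\<lambda>_ S' C' D'. S' = S \<and> C' = C \<and> held m C D' \<and>
       (\<exists>zs. mset zs = mset xs + mset ys \<and> D' = D(2 * k + 1 := [], 2 * k + 2 := [], k := D k @ zs))"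
  \<comment> \<open>Both base cases at once: one half is exhausted, \<open>c\<close> is the buffer
    of the other and \<open>us\<close> its content.\<close>
  have move: "wp (for_loop (length us) (\<lambda>_. move_p c k)) 0 (6 * (a + b)) ?Q S C D"
    if "c = 2 * k + 1 \<and> us = xs \<and> ys = [] \<or> c = 2 * k + 2 \<and> us = ys \<and> xs = []" for c us
  proof -
    have eq: "D(2 * k + 1 := [], 2 * k + 2 := [], k := D k @ us) = D(c := [], k := D k @ us)"
      using that less.prems by (auto simp: fun_eq_iff)
    have "wp (for_loop (length us) (\<lambda>_. move_p c k)) 0 (2 * length us)
      (\<lambda>_ S' C' D'. S' = S \<and> C' = C \<and> held m C D' \<and> D' = D(c := [], k := D k @ us)) S C D"
      by (rule wp_move_loop) (use that less.prems in auto)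
    then show ?thesis
    proof (rule wp_conseq)
      fix S' C' D'
      assume "S' = S \<and> C' = C \<and> held m C D' \<and> D' = D(c := [], k := D k @ us)"
      moreover have "mset us = mset xs + mset ys" using that by auto
      ultimately show "?Q () S' C' D'"
        by (intro conjI exI[of _ us]; simp only: eq)
    qed (use that less.prems(5,6) in auto)
  qed
  show ?case
  proof (cases a)
    case 0
    then show ?thesis using move[of "2 * k + 2" ys] less.prems(5,6) by simp
  next
    case a: (Suc a')
    show ?thesis
    proof (cases b)
      case 0
      then show ?thesis using move[of "2 * k + 1" xs] less.prems(5,6) a by (simp del: for_loop.simps)
    next
      case b: (Suc b')
      obtain x xs' where xs: "xs = x # xs'" using less.prems(5) a by (cases xs) auto
      obtain y ys' where ys: "ys = y # ys'" using less.prems(6) b by (cases ys) auto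
      let ?D1 = "D(2 * k + 1 := xs', k := D k @ [x])" and ?D2 = "D(2 * k + 2 := ys', k := D k @ [y])"
      \<comment> \<open>Common to both outcomes of the comparison: \<open>z\<close> has been moved
        from buffer \<open>c\<close>, leaving \<open>ws\<close>, and \<open>us\<close>,
        \<open>vs\<close> are what remains to be merged.\<close>
      have post: "?Q () S' C' D''"
        if sorted: "S' = S \<and> C' = C \<and> held m C D'' \<and> (\<exists>zs. mset zs = mset us + mset vs \<and>
            D'' = D'(2 * k + 1 := [], 2 * k + 2 := [], k := D' k @ zs))"
          and D': "D' = D(c := ws, k := D k @ [z])" "c = 2 * k + 1 \<or> c = 2 * k + 2"
          and "add_mset z (mset us + mset vs) = mset xs + mset ys"
        for S' C' D'' D' us vs ws z c
      proof -
        obtain zs where zs: "mset zs = mset us + mset vs"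
            "D'' = D'(2 * k + 1 := [], 2 * k + 2 := [], k := D' k @ zs)"
          using sorted by blast
        have "D'' = D(2 * k + 1 := [], 2 * k + 2 := [], k := D k @ z # zs)"
          unfolding zs(2) using D' by (auto simp: fun_eq_iff)
        moreover have "mset (z # zs) = mset xs + mset ys" using zs(1) that(4) by simp
        ultimately show ?thesis using sorted by blast
      qed
      have A: "wp (merge \<rho> k a' (Suc b')) 0 (6 * (a' + Suc b')) ?Q S C ?D1" if h: "held m C ?D1"
      proof (rule wp_post[OF less.hyps[OF _ h, of a' "Suc b'" xs' ys]])
        fix S' C' D''
        assume "S' = S \<and> C' = C \<and> held m C D'' \<and> (\<exists>zs. mset zs = mset xs' + mset ys \<and>
            D'' = ?D1(2 * k + 1 := [], 2 * k + 2 := [], k := ?D1 k @ zs))"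
        then show "?Q () S' C' D''" by (rule post[OF _ refl]) (use xs ys in auto)
      qed (use less.prems a b xs ys in auto)
      have B: "wp (merge \<rho> k (Suc a') b') 0 (6 * (Suc a' + b')) ?Q S C ?D2" if h: "held m C ?D2"
      proof (rule wp_post[OF less.hyps[OF _ h, of "Suc a'" b' xs ys']])
        fix S' C' D''
        assume "S' = S \<and> C' = C \<and> held m C D'' \<and> (\<exists>zs. mset zs = mset xs + mset ys' \<and>
            D'' = ?D2(2 * k + 1 := [], 2 * k + 2 := [], k := ?D2 k @ zs))"
        then show "?Q () S' C' D''" by (rule post[OF _ refl]) (use xs ys in auto)
      qed (use less.prems a b xs ys in auto)
      show ?thesis unfolding a b merge.simps
        apply (rule wp_weaken)
          apply (rule wp_bind, rule wp_peek_p)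
          apply (rule wp_bind, rule wp_peek_p)
          apply (rule wp_bind, rule wp_eval_perm)
          apply (rule wp_bind, rule wp_eval_perm)
          apply (rule wp_if)
           apply (rule wp_bind, rule wp_move_p[OF less.prems(1,2), of _ x xs'])
             apply (use less.prems xs A in auto)[3]
          apply (rule wp_bind, rule wp_move_p[OF less.prems(1,2), of _ y ys'])
            apply (use less.prems ys B in auto)[3]
         apply simp_all
        done
    qed
  qed
qed

text \<open>With \<open>c = b + 1\<close> and \<open>d = k + 1\<close> this excludes that
  \<open>b\<close> is a proper descendant of \<open>k\<close> in the heap numbering when
  \<open>b + 1 < 2 * (k + 1)\<close>.\<close>

lemma div_pow_Suc_less: "(c::nat) < 2 * d \<Longrightarrow> c div 2 ^ Suc i < d"
  by (metis div_le_dividend div_mult2_eq less_mult_imp_div_less mult.commute order_le_less_trans power_Suc)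

text \<open>The descendants of \<open>k\<close> in the heap numbering are the \<open>b\<close> with \<open>(b + 1) div 2 ^ Suc i = k + 1\<close>.\<close>

lemma wp_merge_sort:
  assumes "held m C D" "m \<le> M" "length (D k) = l" "l \<le> 2 ^ L"
    and "\<And>b i. (b + 1) div 2 ^ Suc i = k + 1 \<Longrightarrow> D b = []"
  shows "wp (merge_sort \<rho> k l) 0 (10 * l * L + 1)
    (\<lambda>_ S' C' D'. S' = S \<and> C' = C \<and> held m C D' \<and> (\<exists>zs. mset zs = mset (D k) \<and> D' = D(k := zs))) S C D"
  using assms
\<comment> \<open>\<open>L\<close> bounds the depth of the recursion: both halves of at most
  \<open>2 ^ Suc L\<close> elements, also the one rounded up, have at most
  \<open>2 ^ L\<close>.\<close>
proof (induction L arbitrary: k l D)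
  case 0
  then have "l \<le> 1" by simp
  show ?case
    by (subst merge_sort.simps, rule wp_weaken, rule wp_if, rule wp_tick)
       (use 0 \<open>l \<le> 1\<close> in \<open>auto intro!: exI[of _ "D k"]\<close>)
next
  case (Suc L)
  show ?case
  proof (cases "l \<le> 1")
    case True
    have "merge_sort \<rho> k l = tick" using True by (simp add: merge_sort.simps)
    show ?thesis unfolding \<open>merge_sort \<rho> k l = tick\<close>
      by (rule wp_weaken[OF wp_tick]) (use Suc.prems(1) in \<open>auto intro!: exI[of _ "D k"]\<close>)
  next
    case False
    let ?a = "l div 2" and ?b = "l - l div 2"
    define xs ys where "xs = take ?a (D k)" and "ys = drop ?a (D k)"
    have D: "D k = xs @ ys" and len: "length xs = ?a" "length ys = ?b"
      using Suc.prems(3) by (auto simp: xs_def ys_def)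
    \<comment> \<open>Pushes append, so after the split the children hold exactly the two halves
      only because they were empty before.\<close>
    have child: "D (2 * k + 1) = []" "D (2 * k + 2) = []"
      using Suc.prems(5)[of "2 * k + 1" 0] Suc.prems(5)[of "2 * k + 2" 0] by simp_all
    \<comment> \<open>A descendant of a child reaches \<open>k\<close> by one more halving, so its
      emptiness is inherited from the hypothesis on \<open>k\<close>.\<close>
    have sub: "D b = []" if "(b + 1) div 2 ^ Suc i = 2 * k + 1 + 1 \<or> (b + 1) div 2 ^ Suc i = 2 * k + 2 + 1" for b i
    proof (rule Suc.prems(5)[of b "Suc i"])
      have "(b + 1) div 2 ^ Suc (Suc i) = (b + 1) div 2 ^ Suc i div 2"
        by (metis div_mult2_eq mult.commute power_Suc)
      then show "(b + 1) div 2 ^ Suc (Suc i) = k + 1" using that by auto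
    qed
    \<comment> \<open>The buffers touched at this level are no descendants of the children: their
      numbers plus one are at most \<open>2 * k + 3\<close>, less than twice
      \<open>2 * k + 2\<close>.\<close>
    have nd: "b \<noteq> k \<and> b \<noteq> 2 * k + 1 \<and> b \<noteq> 2 * k + 2"
      if "(b + 1) div 2 ^ Suc i = 2 * k + 1 + 1 \<or> (b + 1) div 2 ^ Suc i = 2 * k + 2 + 1" for b i
      using that div_pow_Suc_less[of "b + 1" "2 * k + 2" i] by auto
    let ?D1 = "D(k := ys, 2 * k + 1 := xs)"
    let ?D2 = "D(k := [], 2 * k + 1 := xs, 2 * k + 2 := ys)"
    have s1: "wp (for_loop ?a (\<lambda>_. move_p k (2 * k + 1))) 0 (2 * ?a)
      (\<lambda>_ S' C' D'. S' = S \<and> C' = C \<and> held m C D' \<and> D' = ?D1) S C D"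
      by (rule wp_post, rule wp_move_loop[of m _ _ _ xs ys]) (use Suc.prems D len child in auto)
    have s2: "wp (for_loop ?b (\<lambda>_. move_p k (2 * k + 2))) 0 (2 * ?b)
      (\<lambda>_ S' C' D'. S' = S \<and> C' = C \<and> held m C D' \<and> D' = ?D2) S C ?D1" if "held m C ?D1"
      by (rule wp_post, rule wp_move_loop[of m _ _ _ ys "[]"])
         (use that Suc.prems D len child in \<open>auto simp: fun_upd_twist\<close>)
    \<comment> \<open>\<open>D'\<close> may differ from \<open>D\<close> only at \<open>k\<close>
      and its two children. Both recursive calls start from such buffers, the second with the first
      child already rearranged.\<close>
    have ih: "wp (merge_sort \<rho> c l') 0 (10 * l' * L + 1)
      (\<lambda>_ S' C' D''. S' = S \<and> C' = C \<and> held m C D'' \<and> (\<exists>zs. mset zs = mset (D' c) \<and> D'' = D'(c := zs))) S C D'"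
      if h: "held m C D'" and c: "c = 2 * k + 1 \<or> c = 2 * k + 2" and l': "length (D' c) = l'" "l' \<le> 2 ^ L"
        and other: "\<And>b. b \<noteq> k \<Longrightarrow> b \<noteq> 2 * k + 1 \<Longrightarrow> b \<noteq> 2 * k + 2 \<Longrightarrow> D' b = D b" for c l' D'
    proof (rule Suc.IH[OF h Suc.prems(2) l'])
      fix b i
      assume "(b + 1) div 2 ^ Suc i = c + 1"
      then have "(b + 1) div 2 ^ Suc i = 2 * k + 1 + 1 \<or> (b + 1) div 2 ^ Suc i = 2 * k + 2 + 1"
        using c by blast
      then show "D' b = []" using nd sub other by metis
    qed
    have le: "?a \<le> 2 ^ L" "?b \<le> 2 ^ L" using Suc.prems(4) by auto
    have s3: "wp (merge_sort \<rho> (2 * k + 1) ?a) 0 (10 * ?a * L + 1)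
      (\<lambda>_ S' C' D'. S' = S \<and> C' = C \<and> held m C D' \<and>
        (\<exists>us. mset us = mset xs \<and> D' = ?D2(2 * k + 1 := us))) S C ?D2" if h: "held m C ?D2"
      by (rule wp_post[OF ih[OF h]]) (use len le in auto)
    have s4: "wp (merge_sort \<rho> (2 * k + 2) ?b) 0 (10 * ?b * L + 1)
      (\<lambda>_ S' C' D''. S' = S \<and> C' = C \<and> held m C D'' \<and>
        (\<exists>vs. mset vs = mset ys \<and> D'' = D'(2 * k + 2 := vs))) S C D'"
      if h: "held m C D'" and D': "D' = ?D2(2 * k + 1 := us)" for D' us
      by (rule wp_post[OF ih[OF h]]) (use len le in \<open>auto simp: D'\<close>)
    have s5: "wp (merge \<rho> k ?a ?b) 0 (6 * (?a + ?b))
       (\<lambda>_ S' C' D'. S' = S \<and> C' = C \<and> held m C D' \<and> (\<exists>zs. mset zs = mset (D k) \<and> D' = D(k := zs))) S C D'"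
      if h: "held m C D'" and D': "D' = ?D2(2 * k + 1 := us, 2 * k + 2 := vs)"
        and uv: "mset us = mset xs" "mset vs = mset ys" for D' us vs
    proof (rule wp_post, rule wp_merge[OF h, of k us vs])
      fix S' C' D''
      assume "S' = S \<and> C' = C \<and> held m C D'' \<and> (\<exists>zs. mset zs = mset us + mset vs \<and>
         D'' = D'(2 * k + 1 := [], 2 * k + 2 := [], k := D' k @ zs))"
      then obtain zs where zs: "S' = S" "C' = C" "held m C D''" "mset zs = mset us + mset vs"
         "D'' = D'(2 * k + 1 := [], 2 * k + 2 := [], k := D' k @ zs)" by blast
      have "D'' = D(k := zs)" unfolding zs(5) D' using child by (auto simp: fun_eq_iff)
      then show "S' = S \<and> C' = C \<and> held m C D'' \<and> (\<exists>zs. mset zs = mset (D k) \<and> D'' = D(k := zs))"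
        using zs(1-4) uv D by auto
    qed (use Suc.prems(2) len D' mset_eq_length[OF uv(1)] mset_eq_length[OF uv(2)] in simp_all)
    \<comment> \<open>Origin of the constant 10: per level, each element costs 2 steps for the split
      and at most 6 for the merge. The other \<open>2 * l\<close> absorb the tick and the summands 1
      of the two recursive calls.\<close>
    have cost: "0 + (1 + (2 * ?a + (2 * ?b + ((10 * ?a * L + 1) + ((10 * ?b * L + 1) + 6 * (?a + ?b))))))
       \<le> 10 * l * Suc L + 1"
    proof -
      have "10 * a * L + 10 * b * L = 10 * l * L" if "a + b = l" for a b
        using that by (auto simp: algebra_simps)
      moreover have "0 + (1 + (2 * a + (2 * b + ((X + 1) + ((Y + 1) + 6 * (a + b)))))) \<le> 10 * l + Z + 1"
        if "a + b = l" "X + Y = Z" for a b X Y Z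
        using that False by arith
      ultimately show ?thesis unfolding mult_Suc_right by simp
    qed
    have eq: "merge_sort \<rho> k l = do {
       tick;
       for_loop ?a (\<lambda>_. move_p k (2 * k + 1));
       for_loop ?b (\<lambda>_. move_p k (2 * k + 2));
       merge_sort \<rho> (2 * k + 1) ?a;
       merge_sort \<rho> (2 * k + 2) ?b;
       merge \<rho> k ?a ?b }"
      using False by (subst merge_sort.simps) simp
    show ?thesis unfolding eq
      apply (rule wp_weaken)
        apply (rule wp_bind, rule wp_tick)
        apply (rule wp_bind, rule wp_post[OF s1])
        apply (elim conjE, hypsubst)
        apply (rule wp_bind, rule wp_post[OF s2], assumption)
        apply (elim conjE, hypsubst)
        apply (rule wp_bind, rule wp_post[OF s3], assumption)
        apply (elim conjE exE, hypsubst)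
        apply (rule wp_bind, rule wp_post[OF s4], assumption, rule refl)
        apply (elim conjE exE, hypsubst)
        apply (rule s5, assumption, rule refl, assumption, assumption)
      using cost by simp_all
  qed
qed

end

section \<open>Blocks of arrays and destinations of elements\<close>

text \<open>\<open>T\<close> is viewed at two widths: as \<open>s\<close> buckets of width
  \<open>s * cap\<close>, and as \<open>s * s\<close> batches of width \<open>cap\<close>, where
  batch \<open>i\<close> of bucket \<open>j\<close> has number \<open>j * s + i\<close>.\<close>

definition block :: "nat \<Rightarrow> nat \<Rightarrow> 'a list \<Rightarrow> 'a list" where
  "block c b xs = take c (drop (b * c) xs)"

lemma map_block: "map f (block c b xs) = block c b (map f xs)"
  by (simp add: block_def take_map drop_map)

lemma length_block: "(b + 1) * c \<le> length xs \<Longrightarrow> length (block c b xs) = c"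
  by (simp add: block_def)

lemma set_block_subset: "set (block c b xs) \<subseteq> set xs"
  unfolding block_def by (meson set_drop_subset set_take_subset subset_trans)

lemma length_write_range:
  "loc + length a \<le> length xs \<Longrightarrow> length (write_range loc a xs) = length xs"
  by (simp add: write_range_def)

lemma block_write_range:
  assumes "length a = c" "(b + 1) * c \<le> length xs"
  shows "block c b' (write_range (b * c) a xs) = (if b' = b then a else block c b' xs)"
proof -
  consider "b' = b" | "b' + 1 \<le> b" | "b + 1 \<le> b'" by linarith
  then show ?thesis
  proof cases
    case 1
    then show ?thesis using assms by (simp add: block_def write_range_def)
  next
    case 2
    then have le: "b' * c + c \<le> b * c" using mult_le_mono1[OF 2, of c] by simp
    then have "drop (b' * c) (write_range (b * c) a xs) =
        drop (b' * c) (take (b * c) xs) @ a @ drop (b * c + c) xs"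
      using assms 2 by (simp add: write_range_def)
    then show ?thesis using le assms 2 by (simp add: block_def drop_take min_def)
  next
    case 3
    then have le: "b * c + c \<le> b' * c" using mult_le_mono1[OF 3, of c] by simp
    then show ?thesis using assms 3 by (simp add: block_def write_range_def)
  qed
qed

text \<open>The offset \<open>d\<close> serves two decompositions: of a whole array into blocks
  (\<open>d = 0\<close>) and of one bucket of \<open>T\<close> into its batches
  (\<open>d = j * (s * c)\<close>).\<close>

lemma take_mult_concat:
  "take (n * c) (drop d xs) = concat (map (\<lambda>i. take c (drop (d + i * c) xs)) [0..<n])"
proof (induction n)
  case (Suc n)
  have "take (Suc n * c) (drop d xs) = take (n * c) (drop d xs) @ take c (drop (n * c) (drop d xs))"
    by (metis add.commute mult_Suc take_add)
  then show ?case using Suc by (simp add: add.commute)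
qed simp

lemma concat_blocks: "length xs = n * c \<Longrightarrow> concat (map (\<lambda>b. block c b xs) [0..<n]) = xs"
  using take_mult_concat[of n c 0 xs] by (simp add: block_def)

lemma block_concat_blocks: "block (s * c) j xs = concat (map (\<lambda>i. block c (j * s + i) xs) [0..<s])"
  using take_mult_concat[of s c "j * (s * c)" xs] by (simp add: block_def algebra_simps)

lemma mult_add_eq_iff:
  fixes s :: nat
  assumes "i < s" "i' < s"
  shows "j * s + i = j' * s + i' \<longleftrightarrow> j = j' \<and> i = i'"
proof
  assume eq: "j * s + i = j' * s + i'"
  have "(j * s + i) div s = j" "(j' * s + i') div s = j'" using assms by simp_all
  with eq show "j = j' \<and> i = i'" by simp
qed simp

lemma mult_add_less:
  fixes s :: nat
  assumes "j < s" "i < s"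
  shows "j * s + i + 1 \<le> s * s"
proof -
  have "j * s + s \<le> s * s" using assms(1) mult_le_mono1[of "j + 1" s s] by simp
  then show ?thesis using assms(2) by linarith
qed

text \<open>Batch \<open>i\<close> of bucket \<open>j\<close> starts at
  \<open>(j * s + i) * c\<close>, and distinct \<open>j\<close> give distinct block numbers, so the
  ranges of one operation never overwrite each other. The number \<open>k\<close> of ranges already
  written is general for the induction; the distribution phase uses \<open>k = s\<close>.\<close>

lemma fold_write_range:
  fixes k :: nat
  assumes "length T = s * s * c" "i < s" "\<And>j. j < s \<Longrightarrow> length (C j) = c" "k \<le> s"
  defines "T' \<equiv> \<lambda>k. fold (\<lambda>(loc, b). write_range loc (C b)) (map (\<lambda>j. (j * (s * c) + i * c, j)) [0..<k]) T"
  shows "length (T' k) = s * s * c"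
    and "j < s \<Longrightarrow> i' < s \<Longrightarrow>
      block c (j * s + i') (T' k) = (if i' = i \<and> j < k then C j else block c (j * s + i') T)"
proof -
  have "length (T' k) = s * s * c \<and> (\<forall>j<s. \<forall>i'<s.
      block c (j * s + i') (T' k) = (if i' = i \<and> j < k then C j else block c (j * s + i') T))"
    using assms(4)
  proof (induction k)
    case 0
    then show ?case using assms(1) by (simp add: T'_def)
  next
    case (Suc k)
    have T': "T' (Suc k) = write_range ((k * s + i) * c) (C k) (T' k)"
      by (simp add: T'_def algebra_simps)
    have fit: "(k * s + i + 1) * c \<le> length (T' k)"
      using Suc mult_le_mono1[OF mult_add_less[of k s i], of c] assms(2) by simp
    have len: "length (C k) = c" using assms(3) Suc.prems by simp
    have "length (T' (Suc k)) = s * s * c"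
      unfolding T' using fit len Suc by (subst length_write_range) (simp_all add: algebra_simps)
    moreover have "block c (j * s + i') (T' (Suc k)) =
        (if i' = i \<and> j < Suc k then C j else block c (j * s + i') T)" if "j < s" "i' < s" for j i'
      unfolding T' block_write_range[OF len fit] mult_add_eq_iff[OF that(2) assms(2)]
      using Suc that by auto
    ultimately show ?case by blast
  qed
  then show "length (T' k) = s * s * c"
    and "j < s \<Longrightarrow> i' < s \<Longrightarrow>
      block c (j * s + i') (T' k) = (if i' = i \<and> j < k then C j else block c (j * s + i') T)"
    by auto
qed

section \<open>Keys, permutations and destination buckets\<close>

definition all_keys :: "nat \<Rightarrow> 'v item list \<Rightarrow> bool" where
  "all_keys n es \<longleftrightarrow> length es = n \<and> None \<notin> set es \<and> distinct (map item_key es) \<and>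
     item_key ` set es \<subseteq> {1..n}"

text \<open>Carries the hypothesis on the input over to the second pass, whose input is known only
  up to order.\<close>

lemma all_keys_mset_cong:
  assumes "mset es = mset es'" "all_keys n es"
  shows "all_keys n es'"
proof -
  have "mset (map item_key es) = mset (map item_key es')" using assms(1) by simp
  then show ?thesis
    using assms mset_eq_length[OF assms(1)] mset_eq_setD[OF assms(1)] mset_eq_imp_distinct_iff
    unfolding all_keys_def by metis
qed

lemma all_keys_image:
  assumes "all_keys n es"
  shows "item_key ` set es = {1..n}"
proof (rule card_subset_eq)
  have "card (set (map item_key es)) = length (map item_key es)"
    using assms by (intro distinct_card) (simp add: all_keys_def)
  then show "card (item_key ` set es) = card {1..n}" using assms by (simp add: all_keys_def)
qed (use assms in \<open>auto simp: all_keys_def\<close>)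

lemma input_array_all_keys:
  assumes "input_array dec n I"
  shows "all_keys n (map dec I)"
proof -
  obtain xs where xs: "map dec I = map Some xs" "length xs = n" "distinct (map fst xs)"
      "fst ` set xs \<subseteq> {1..n}"
    using assms by (auto simp: input_array_def)
  have "map item_key (map Some xs) = map fst xs" by (simp add: item_key_def)
  then show ?thesis
    unfolding all_keys_def xs(1) using xs(2-4) by (simp add: item_key_def o_def image_image image_iff)
qed

definition dest :: "nat \<Rightarrow> (nat \<Rightarrow> nat) \<Rightarrow> 'v item \<Rightarrow> nat" where
  "dest s \<rho> e = (\<rho> (item_key e) - 1) div s"

lemma dest_less:
  assumes "all_keys (s * s) es" "\<rho> permutes {1..s * s}" "e \<in> set es"
  shows "dest s \<rho> e < s"
proof -
  have "item_key e \<in> {1..s * s}" using assms by (auto simp: all_keys_def)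
  then have "\<rho> (item_key e) \<in> {1..s * s}" using permutes_in_image[OF assms(2)] by blast
  then have "\<rho> (item_key e) - 1 < s * s" by auto
  then show ?thesis unfolding dest_def by (simp add: less_mult_imp_div_less)
qed

text \<open>The count is transferred twice: from elements to keys, which are distinct and exhaust
  \<open>{1..s * s}\<close>, and from keys to positions, as \<open>\<rho>\<close> is injective and
  onto. The positions of bucket \<open>j\<close> are the \<open>s\<close> numbers from
  \<open>j * s + 1\<close> to \<open>j * s + s\<close>; the shift by 1 appears because positions
  start at 1 and buckets at 0.\<close>

lemma length_filter_dest:
  assumes "all_keys (s * s) es" "\<rho> permutes {1..s * s}" "j < s"
  shows "length (filter (\<lambda>e. dest s \<rho> e = j) es) = s"
proof -
  let ?P = "\<lambda>x. (x - 1) div s = j"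
  have "length (filter (\<lambda>e. dest s \<rho> e = j) es) = length (filter (\<lambda>x. ?P (\<rho> x)) (map item_key es))"
    by (simp add: filter_map o_def dest_def)
  also have "\<dots> = card {x \<in> {1..s * s}. ?P (\<rho> x)}"
    using assms(1) all_keys_image[OF assms(1)]
    by (subst distinct_card[symmetric]) (simp_all add: all_keys_def)
  also have "\<dots> = card (\<rho> ` {x \<in> {1..s * s}. ?P (\<rho> x)})"
    using permutes_inj[OF assms(2)] by (intro card_image[symmetric]) (simp add: inj_on_def)
  also have "\<rho> ` {x \<in> {1..s * s}. ?P (\<rho> x)} = {y \<in> {1..s * s}. ?P y}"
  proof (intro set_eqI iffI)
    fix y assume y: "y \<in> {y \<in> {1..s * s}. ?P y}"
    then obtain x where "x \<in> {1..s * s}" "y = \<rho> x" using permutes_image[OF assms(2)] by blast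
    with y show "y \<in> \<rho> ` {x \<in> {1..s * s}. ?P (\<rho> x)}" by blast
  qed (use permutes_in_image[OF assms(2)] in blast)
  also have "\<dots> = {j * s + 1..j * s + s}"
  proof (intro set_eqI iffI)
    fix y assume "y \<in> {y \<in> {1..s * s}. ?P y}"
    then have y: "1 \<le> y" "(y - 1) div s = j" by auto
    have "(y - 1) mod s < s" using assms(3) by simp
    moreover have "j * s + (y - 1) mod s = y - 1" using y(2) div_mult_mod_eq[of "y - 1" s] by simp
    ultimately show "y \<in> {j * s + 1..j * s + s}" using y(1) unfolding atLeastAtMost_iff by linarith
  next
    fix y assume y: "y \<in> {j * s + 1..j * s + s}"
    then have "y - 1 = j * s + (y - 1 - j * s)" "y - 1 - j * s < s" by auto
    then have "(y - 1) div s = j" by (metis div_mult_self3 div_less add.right_neutral not_less_zero)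
    moreover have "y \<le> s * s" using y mult_le_mono1[of "j + 1" s s] assms(3) by auto
    ultimately show "y \<in> {y \<in> {1..s * s}. ?P y}" using y by auto
  qed
  finally show ?thesis by simp
qed

lemma sum_mset_filter:
  assumes "\<And>e. e \<in> set es \<Longrightarrow> f e < (s :: nat)"
  shows "(\<Sum>j<s. mset (filter (\<lambda>e. f e = j) es)) = mset es"
proof (rule multiset_eqI)
  fix e
  have "count (\<Sum>j<s. mset (filter (\<lambda>e. f e = j) es)) e = (\<Sum>j<s. if j = f e then count (mset es) e else 0)"
    by (auto simp: count_sum intro!: sum.cong)
  also have "\<dots> = count (mset es) e"
    using assms[of e] by (auto simp: count_eq_zero_iff)
  finally show "count (\<Sum>j<s. mset (filter (\<lambda>e. f e = j) es)) e = count (mset es) e" .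
qed

lemma mset_concat_blocks:
  assumes "length xs = s * s"
  shows "mset xs = (\<Sum>j<s. mset (block s j xs))"
proof -
  have "mset (concat (map (\<lambda>j. block s j xs) [0..<n])) = (\<Sum>j<n. mset (block s j xs))" for n
    by (induction n) simp_all
  then show ?thesis using concat_blocks[OF assms] by metis
qed

section \<open>The shuffle\<close>

text \<open>One decrypted element: the pop on the ciphertext side pays for the push on the plaintext
  side.\<close>

lemma held_shift_cp:
  assumes "held m C D" "C b = c # cs"
  shows "held m (C(b := cs)) (D(b' := D b' @ [e]))"
proof -
  have m: "m \<ge> 1" using assms(1) by (simp add: held_def mem_def)
  have "held (m - 1) (C(b := cs)) D"
    using m assms(2) by (intro held_upd_c[OF assms(1)]) simp
  then show ?thesis by (rule held_upd_p) (use m in simp)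
qed

lemma held_shift_pc:
  assumes "held m C D" "D b = e # es"
  shows "held m (C(b' := C b' @ [c])) (D(b := es))"
proof -
  have m: "m \<ge> 1" using assms(1) by (simp add: held_def mem_def)
  have "held (m - 1) C (D(b := es))"
    using m assms(2) by (intro held_upd_p[OF assms(1)]) simp
  then show ?thesis by (rule held_upd_c) (use m in simp)
qed

text \<open>The bounds add the two sizes that occur, \<open>s\<close> for a bucket of
  \<open>I\<close> or \<open>O\<close> and \<open>s * cap\<close> for a bucket of \<open>T\<close>
  or a full set of batches. The first is not covered by the second: for n = 1 the logarithm makes
  \<open>cap\<close> zero.\<close>

locale melbourne =
  budget "8 + s + s * cap" "s + s * cap" "s * s * cap + 2 * (s * s)" for s cap :: nat +
  fixes enc :: "nat \<Rightarrow> 'v item \<Rightarrow> 'c" and dec :: "'c \<Rightarrow> 'v item"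
  assumes dec_enc: "dec (enc r e) = e"
begin

abbreviation "M \<equiv> 8 + s + s * cap"

abbreviation cb :: "'c list \<Rightarrow> nat \<Rightarrow> 'c list" where
  "cb cs \<equiv> (\<lambda>_. [])(0 := cs)"

abbreviation no_c :: "nat \<Rightarrow> 'c list" where "no_c \<equiv> \<lambda>_. []"
abbreviation no_p :: "nat \<Rightarrow> 'v item list" where "no_p \<equiv> \<lambda>_. []"

lemma held_cb: "8 + length cs \<le> m \<Longrightarrow> held m (cb cs) no_p"
  by (rule held_upd_c[OF held_empty]) simp

text \<open>Plaintexts leave at the front of buffer \<open>j\<close> while ciphertexts join the
  ciphertext buffer of the same number, so the total never grows. Randomizers are forgotten; only
  what the new ciphertexts decrypt to is recorded.\<close>

lemma wp_encrypt_loop: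
  assumes "held m C D" "m \<le> M" "length (D j) = n"
  shows "wp (for_loop n (\<lambda>_. do { e \<leftarrow> pop_p j; c \<leftarrow> encrypt enc e; push_c j c })) 0 (3 * n)
    (\<lambda>_ S' C' D'. S' = S \<and> held m C' D' \<and>
       (\<exists>cs. map dec cs = D j \<and> C' = C(j := C j @ cs) \<and> D' = D(j := []))) S C D"
proof -
  let ?P = "\<lambda>k S' C' D'. S' = S \<and> held m C' D' \<and>
       (\<exists>cs. map dec cs = take k (D j) \<and> C' = C(j := C j @ cs) \<and> D' = D(j := drop k (D j)))"
  have "wp (for_loop n (\<lambda>_. do { e \<leftarrow> pop_p j; c \<leftarrow> encrypt enc e; push_c j c })) (n * 0) (n * 3)
    (\<lambda>_. ?P n) S C D"
  proof (rule wp_for[where P = ?P])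
    show "?P 0 S C D" using assms(1) by (auto intro: exI[of _ "[]"])
  next
    fix k S' C' D'
    assume k: "k < n" and "?P k S' C' D'"
    then obtain cs where P: "S' = S" "held m C' D'" "map dec cs = take k (D j)"
        "C' = C(j := C j @ cs)" "D' = D(j := drop k (D j))" by blast
    have d: "drop k (D j) = D j ! k # drop (Suc k) (D j)" "take (Suc k) (D j) = take k (D j) @ [D j ! k]"
      using k assms(3) by (auto simp: Cons_nth_drop_Suc take_Suc_conv_app_nth)
    let ?C = "\<lambda>c. C'(j := C' j @ [c])" and ?D = "D'(j := drop (Suc k) (D j))"
    have h: "held m (?C c) ?D" for c
      by (rule held_shift_pc[OF P(2)]) (use P(5) d in simp)
    have Q: "?P (Suc k) S (?C (enc r (D j ! k))) ?D" for r
    proof -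
      have "map dec (cs @ [enc r (D j ! k)]) = take (Suc k) (D j)" using P(3) d(2) dec_enc by simp
      moreover have "?C (enc r (D j ! k)) = C(j := C j @ (cs @ [enc r (D j ! k)]))" using P(4) by simp
      moreover have "?D = D(j := drop (Suc k) (D j))" using P(5) by simp
      ultimately show ?thesis using h by blast
    qed
    have D': "tl (D' j) = drop (Suc k) (D j)" "hd (D' j) = D j ! k" using P(5) d(1) by simp_all
    show "wp (do { e \<leftarrow> pop_p j; c \<leftarrow> encrypt enc e; push_c j c }) 0 3 (\<lambda>_. ?P (Suc k)) S' C' D'"
      apply (rule wp_weaken)
        apply (rule wp_bind, rule wp_pop_p)
        apply (rule wp_bind, rule wp_encrypt)
        apply (rule wp_push_c)
         apply (unfold D' P(1))
         apply (rule held_mono[OF h assms(2)])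
        apply (rule Q)
       apply simp_all
      done
  qed
  then show ?thesis using assms(3) by (simp add: mult.commute)
qed

section \<open>Distribution phase\<close>

lemma wp_load_loop:
  assumes "length cs = s"
  shows "wp (for_loop s (\<lambda>_. do {
       c \<leftarrow> pop_c 0;
       e \<leftarrow> decrypt dec c;
       y \<leftarrow> eval_perm \<rho> (item_key e);
       push_p ((y - 1) div s) e })) 0 (s * 4)
    (\<lambda>_ S' C' D'. S' = S \<and> C' = no_c \<and> D' = (\<lambda>j. filter (\<lambda>e. dest s \<rho> e = j) (map dec cs)) \<and>
       held (8 + s) C' D') S (cb cs) no_p"
proof -
  let ?P = "\<lambda>k S' C' D'. S' = S \<and> C' = cb (drop k cs) \<and>
     D' = (\<lambda>j. filter (\<lambda>e. dest s \<rho> e = j) (map dec (take k cs))) \<and> held (8 + s) C' D'"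
  have "wp (for_loop s (\<lambda>_. do {
       c \<leftarrow> pop_c 0;
       e \<leftarrow> decrypt dec c;
       y \<leftarrow> eval_perm \<rho> (item_key e);
       push_p ((y - 1) div s) e })) (s * 0) (s * 4) (\<lambda>_. ?P s) S (cb cs) no_p"
  proof (rule wp_for[where P = ?P])
    show "?P 0 S (cb cs) no_p" using assms by (auto intro: held_cb)
  next
    fix k S' C' D'
    assume k: "k < s" and P: "?P k S' C' D'"
    have d: "drop k cs = cs ! k # drop (Suc k) cs" "take (Suc k) cs = take k cs @ [cs ! k]"
      using k assms by (auto simp: Cons_nth_drop_Suc take_Suc_conv_app_nth)
    let ?e = "dec (cs ! k)"
    let ?b = "dest s \<rho> ?e"
    \<comment> \<open>The plaintext buffer of a single destination may receive up to
      \<open>s\<close> elements; only the total with the unread ciphertexts is bounded.\<close>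
    have h: "held (8 + s) (C'(0 := drop (Suc k) cs)) (D'(?b := D' ?b @ [?e]))"
      by (rule held_shift_cp) (use P d in auto)
    have "C'(0 := drop (Suc k) cs) = cb (drop (Suc k) cs)" using P by simp
    moreover have "D'(?b := D' ?b @ [?e]) = (\<lambda>j. filter (\<lambda>e. dest s \<rho> e = j) (map dec (take (Suc k) cs)))"
      by (rule ext) (use P d(2) in simp)
    ultimately have Q: "?P (Suc k) S (C'(0 := drop (Suc k) cs)) (D'(?b := D' ?b @ [?e]))"
      using h by blast
    have C': "tl (C' 0) = drop (Suc k) cs" "hd (C' 0) = cs ! k" using P d(1) by simp_all
    have S': "S' = S" using P by blast
    show "wp (do {
         c \<leftarrow> pop_c 0;
         e \<leftarrow> decrypt dec c;
         y \<leftarrow> eval_perm \<rho> (item_key e);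
         push_p ((y - 1) div s) e }) 0 4 (\<lambda>_. ?P (Suc k)) S' C' D'"
      apply (rule wp_weaken)
        apply (rule wp_bind, rule wp_pop_c)
        apply (rule wp_bind, rule wp_decrypt)
        apply (rule wp_bind, rule wp_eval_perm)
        apply (rule wp_push_p)
         apply (unfold C' S' dest_def[symmetric])
         apply (rule held_mono[OF h], simp)
        apply (rule Q)
       apply simp_all
      done
  qed
  then show ?thesis using assms by (simp add: fun_upd_idem)
qed

text \<open>A failing run owes no postcondition, so everything after the test may assume that no
  batch overflows.\<close>

lemma wp_check_loop:
  "wp (for_loop s (\<lambda>j. do { l \<leftarrow> length_p j; if l > cap then fail else return () })) 0 s
    (\<lambda>_ S' C' D'. S' = S \<and> C' = C \<and> D' = D \<and> (\<forall>j<s. length (D j) \<le> cap)) S C D"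
proof -
  let ?P = "\<lambda>k S' C' D'. S' = S \<and> C' = C \<and> D' = D \<and> (\<forall>j<k. length (D j) \<le> cap)"
  have "wp (for_loop s (\<lambda>j. do { l \<leftarrow> length_p j; if l > cap then fail else return () })) (s * 0) (s * 1)
    (\<lambda>_. ?P s) S C D"
  proof (rule wp_for[where P = ?P])
    fix k S' C' D'
    assume "k < s" and P: "?P k S' C' D'"
    have "wp (if length (D' k) > cap then fail else return ()) (max 0 0) (max 0 0) (\<lambda>_. ?P (Suc k)) S' C' D'"
      by (rule wp_if, rule wp_fail, rule wp_return) (use P in \<open>auto simp: less_Suc_eq\<close>)
    then show "wp (do { l \<leftarrow> length_p k; if l > cap then fail else return () }) 0 1 (\<lambda>_. ?P (Suc k)) S' C' D'"
      by (intro wp_weaken[OF wp_bind[OF wp_length_p]]) simp_all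
  qed simp
  then show ?thesis by simp
qed

text \<open>Padding raises the total by at most \<open>cap\<close>, and encryption then exchanges
  plaintexts for ciphertexts one by one. The work is 1 for the length, at most \<open>cap\<close>
  for dummies and 3 for each of \<open>cap\<close> encryptions.\<close>

lemma wp_pad:
  assumes "held m C D" "m + cap \<le> M" "length (D j) \<le> cap" "C j = []"
  shows "wp (do {
       l \<leftarrow> length_p j;
       for_loop (cap - l) (\<lambda>_. push_p j None);
       for_loop cap (\<lambda>_. do { e \<leftarrow> pop_p j; c \<leftarrow> encrypt enc e; push_c j c }) }) 0 (1 + 4 * cap)
    (\<lambda>_ S' C' D'. S' = S \<and> held (m + cap) C' D' \<and>
       (\<exists>cs. map dec cs = D j @ replicate (cap - length (D j)) None \<and> C' = C(j := cs) \<and> D' = D(j := [])))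
    S C D"
proof -
  let ?l = "length (D j)"
  let ?P = "\<lambda>k S' C' D'. S' = S \<and> C' = C \<and> D' = D(j := D j @ replicate k None) \<and> held (m + k) C' D'"
  have h: "held (m + k) C (D(j := D j @ replicate k None))" for k
    by (rule held_upd_p[OF assms(1)]) simp
  have push: "wp (for_loop (cap - ?l) (\<lambda>_. push_p j None)) ((cap - ?l) * 0) ((cap - ?l) * 1)
    (\<lambda>_. ?P (cap - ?l)) S C D"
  proof (rule wp_for[where P = ?P])
    show "?P 0 S C D" using assms(1) by simp
  next
    fix k S' C' D'
    assume k: "k < cap - ?l" and P: "?P k S' C' D'"
    have eq: "D'(j := D' j @ [None]) = D(j := D j @ replicate (Suc k) None)"
      using P by (simp add: replicate_append_same)
    show "wp (push_p j None) 0 1 (\<lambda>_. ?P (Suc k)) S' C' D'"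
      by (rule wp_push_p; unfold eq) (use P h[of "Suc k"] held_mono[OF h[of "Suc k"], of M] k assms(2) in auto)
  qed
  show ?thesis
    apply (rule wp_weaken)
      apply (rule wp_bind, rule wp_length_p)
      apply (rule wp_bind, rule wp_post[OF push])
      apply (elim conjE, hypsubst)
      apply (rule wp_post, rule wp_encrypt_loop[of "m + cap"])
         apply (erule held_mono)
    using assms(2-4) by auto
qed

text \<open>Batches are described after removal of dummies, so the amount of padding does not enter.
  Only the batches of rounds before \<open>i\<close> are constrained; \<open>T\<close> may hold
  anything at the start.\<close>

definition dist_inv :: "(nat \<Rightarrow> nat) \<Rightarrow> 'v item list \<Rightarrow> nat \<Rightarrow>
    (arr \<Rightarrow> 'c list) \<Rightarrow> (nat \<Rightarrow> 'c list) \<Rightarrow> (nat \<Rightarrow> 'v item list) \<Rightarrow> bool" where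
  "dist_inv \<rho> es i S C D \<longleftrightarrow> C = no_c \<and> D = no_p \<and> map dec (S Arr_I) = es \<and>
     length (S Arr_T) = s * s * cap \<and> length (S Arr_O) = s * s \<and>
     (\<forall>i'<i. \<forall>j<s. filter (\<lambda>e. e \<noteq> None) (map dec (block cap (j * s + i') (S Arr_T))) =
        filter (\<lambda>e. dest s \<rho> e = j) (block s i' es))"

lemma wp_pad_loop:
  assumes "held (8 + s) no_c D" "\<And>j. j < s \<Longrightarrow> length (D j) \<le> cap" "\<And>j. s \<le> j \<Longrightarrow> D j = []"
    and "\<And>j. None \<notin> set (D j)"
  shows "wp (for_loop s (\<lambda>j. do {
       l \<leftarrow> length_p j;
       for_loop (cap - l) (\<lambda>_. push_p j None);
       for_loop cap (\<lambda>_. do { e \<leftarrow> pop_p j; c \<leftarrow> encrypt enc e; push_c j c }) })) 0 (s * (1 + 4 * cap))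
    (\<lambda>_ S' C' D'. S' = S \<and> D' = no_p \<and> (\<forall>j\<ge>s. C' j = []) \<and>
       (\<forall>j<s. length (C' j) = cap \<and> filter (\<lambda>e. e \<noteq> None) (map dec (C' j)) = D j)) S no_c D"
proof -
  let ?body = "\<lambda>j. do {
       l \<leftarrow> length_p j;
       for_loop (cap - l) (\<lambda>_. push_p j None);
       for_loop cap (\<lambda>_. do { e \<leftarrow> pop_p j; c \<leftarrow> encrypt enc e; push_c j c }) }"
  let ?P = "\<lambda>k S' C' D'. S' = S \<and> held (8 + s + k * cap) C' D' \<and> D' = (\<lambda>j. if j < k then [] else D j) \<and>
      (\<forall>j\<ge>k. C' j = []) \<and>
      (\<forall>j<k. length (C' j) = cap \<and> filter (\<lambda>e. e \<noteq> None) (map dec (C' j)) = D j)"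
  have "wp (for_loop s ?body) (s * 0) (s * (1 + 4 * cap)) (\<lambda>_. ?P s) S no_c D"
  proof (rule wp_for[where P = ?P])
    show "?P 0 S no_c D" using assms(1) by simp
  next
    fix k S' C' D'
    assume k: "k < s" and P: "?P k S' C' D'"
    have D': "D' k = D k" using P by simp
    \<comment> \<open>Round \<open>k\<close> adds at most one batch of \<open>cap\<close> elements
      to the \<open>s\<close> loaded ones and the \<open>k\<close> earlier batches; the plaintexts
      consumed so far are not credited.\<close>
    have le: "8 + s + k * cap + cap \<le> M" using mult_le_mono1[of "k + 1" s cap] k by simp
    have body: "wp (?body k) 0 (1 + 4 * cap)
      (\<lambda>_ S'' C'' D''. S'' = S' \<and> held (8 + s + k * cap + cap) C'' D'' \<and>
         (\<exists>cs. map dec cs = D' k @ replicate (cap - length (D' k)) None \<and> C'' = C'(k := cs) \<and> D'' = D'(k := [])))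
      S' C' D'"
      by (rule wp_pad) (use P k le assms(2)[OF k] in auto)
    show "wp (?body k) 0 (1 + 4 * cap) (\<lambda>_. ?P (Suc k)) S' C' D'"
    proof (rule wp_post[OF body], elim conjE exE)
      fix S'' C'' D'' cs
      assume h: "S'' = S'" "held (8 + s + k * cap + cap) C'' D''"
        and cs: "map dec cs = D' k @ replicate (cap - length (D' k)) None"
        and C'': "C'' = C'(k := cs)" and D'': "D'' = D'(k := [])"
      have len: "length cs = cap"
        using arg_cong[OF cs, of length] assms(2)[OF k] D' by simp
      have "filter (\<lambda>e. e \<noteq> None) (D k) = D k"
        using assms(4)[of k] by (intro filter_True) metis
      then have fil: "filter (\<lambda>e. e \<noteq> None) (map dec cs) = D k" unfolding cs D' by simp
      have "D'' = (\<lambda>j. if j < Suc k then [] else D j)" unfolding D'' using P by (auto simp: fun_eq_iff)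
      moreover have "\<forall>j\<ge>Suc k. C'' j = []" using P C'' by auto
      moreover have "\<forall>j<Suc k. length (C'' j) = cap \<and> filter (\<lambda>e. e \<noteq> None) (map dec (C'' j)) = D j"
        using P C'' len fil by (simp add: less_Suc_eq)
      ultimately show "?P (Suc k) S'' C'' D''" using h P by (simp add: add_ac)
    qed
  qed
  then have "wp (for_loop s ?body) 0 (s * (1 + 4 * cap)) (\<lambda>_. ?P s) S no_c D" by simp
  then show ?thesis
  proof (rule wp_post)
    fix S' C' D'
    assume P: "?P s S' C' D'"
    have "D' = no_p" using P assms(3) by (auto simp: fun_eq_iff)
    then show "S' = S \<and> D' = no_p \<and> (\<forall>j\<ge>s. C' j = []) \<and>
       (\<forall>j<s. length (C' j) = cap \<and> filter (\<lambda>e. e \<noteq> None) (map dec (C' j)) = D j)"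
      using P by blast
  qed
qed

text \<open>Work: \<open>1 + s\<close> for the read, \<open>4 * s\<close> for loading,
  \<open>s\<close> for the overflow test, \<open>s * (1 + 4 * cap)\<close> for padding and
  encryption, \<open>s + s * cap\<close> for the write.\<close>

lemma wp_distribute_bucket:
  assumes "all_keys (s * s) es" "\<rho> permutes {1..s * s}" "i < s" "dist_inv \<rho> es i S C D"
  shows "wp (distribute_bucket enc dec s cap \<rho> i) 2 (1 + 8 * s + 5 * s * cap) (\<lambda>_. dist_inv \<rho> es (Suc i)) S C D"
proof -
  note inv = assms(4)[unfolded dist_inv_def]
  define cs where "cs = block s i (S Arr_I)"
  have es: "map dec (S Arr_I) = es" and CD: "C = no_c" "D = no_p" using inv by auto
  have lenI: "length (S Arr_I) = s * s" using inv assms(1) by (auto simp: all_keys_def)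
  have len: "length cs = s" unfolding cs_def
    by (rule length_block) (use lenI assms(3) mult_le_mono1[of "i + 1" s s] in simp)
  have dcs: "map dec cs = block s i es" by (simp add: cs_def map_block es)
  let ?D = "\<lambda>j. filter (\<lambda>e. dest s \<rho> e = j) (map dec cs)"
  have "None \<notin> set (map dec cs)"
    using assms(1) set_block_subset[of s i es] unfolding dcs all_keys_def by blast
  then have noN: "None \<notin> set (?D j)" for j by simp
  \<comment> \<open>Every destination is a bucket below \<open>s\<close>, so no plaintext is left
    behind in a buffer that the padding loop does not visit.\<close>
  have out: "?D j = []" if "s \<le> j" for j
    using that dest_less[OF assms(1,2)] set_block_subset[of s i es]
    unfolding dcs by (fastforce simp: filter_empty_conv)
  have get: "wp (getRange Arr_I (i * s) s 0) 1 (1 + length cs) (\<lambda>_ S' C' D'. S' = S \<and> C' = cb cs \<and> D' = D) S C D"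
    by (rule wp_getRange) (use len CD in \<open>auto simp: cs_def block_def intro!: held_cb\<close>)
  have put: "wp (putRangeDist Arr_T (map (\<lambda>j. (j * (s * cap) + i * cap, j)) [0..<s])) 1 (s + s * cap)
       (\<lambda>_. dist_inv \<rho> es (Suc i)) S C' no_p"
    if C': "\<forall>j\<ge>s. C' j = []"
      "\<forall>j<s. length (C' j) = cap \<and> filter (\<lambda>e. e \<noteq> None) (map dec (C' j)) = ?D j" for C'
  proof -
    let ?rs = "map (\<lambda>j. (j * (s * cap) + i * cap, j)) [0..<s]"
    define T' where "T' = fold (\<lambda>(loc, b). write_range loc (C' b)) ?rs (S Arr_T)"
    have lenT: "length (S Arr_T) = s * s * cap" using inv by blast
    have lC: "length (C' j) = cap" if "j < s" for j using C' that by blast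
    have lenT': "length T' = s * s * cap"
      unfolding T'_def by (rule fold_write_range(1)[OF lenT assms(3) lC order_refl])
    have blT': "block cap (j * s + i') T' = (if i' = i then C' j else block cap (j * s + i') (S Arr_T))"
      if "j < s" "i' < s" for j i'
      unfolding T'_def
      using fold_write_range(2)[where C = C', OF lenT assms(3) lC order_refl that] that(1) by simp
    have "wp (putRangeDist Arr_T ?rs) 1 (length ?rs + s * cap) (\<lambda>_. dist_inv \<rho> es (Suc i)) S C' no_p"
    proof (rule wp_putRangeDist)
      have "(\<Sum>(loc, b)\<leftarrow>?rs. length (C' b)) = (\<Sum>j\<leftarrow>[0..<s]. length (C' j))"
        by (simp add: o_def)
      also have "\<dots> = (\<Sum>j\<leftarrow>[0..<s]. cap)"
        by (rule arg_cong[where f = sum_list], rule map_cong) (use lC in auto)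
      also have "\<dots> = s * cap" by (simp add: sum_list_triv)
      finally show "s * cap = (\<Sum>(loc, b)\<leftarrow>?rs. length (C' b))" by simp
      show "S(Arr_T := T') = S(Arr_T := fold (\<lambda>(loc, b). write_range loc (C' b)) ?rs (S Arr_T))"
        by (simp add: T'_def)
      show "stor (S(Arr_T := T')) \<le> s * s * cap + 2 * (s * s)"
        using inv lenI lenT' by (simp add: stor_def)
      have "(\<lambda>b. if b \<in> snd ` set ?rs then [] else C' b) = no_c"
        using C'(1) by (auto simp: fun_eq_iff image_image)
      moreover have "filter (\<lambda>e. e \<noteq> None) (map dec (block cap (j * s + i') T')) =
          filter (\<lambda>e. dest s \<rho> e = j) (block s i' es)" if "i' < Suc i" "j < s" for i' j
      proof (cases "i' = i")
        case True
        then show ?thesis using blT'[OF that(2) assms(3)] C'(2) that(2) dcs by simp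
      next
        case False
        then have "i' < i" using that(1) by simp
        then show ?thesis using blT'[OF that(2), of i'] assms(3) inv that(2) by simp
      qed
      ultimately show "dist_inv \<rho> es (Suc i) (S(Arr_T := T')) (\<lambda>b. if b \<in> snd ` set ?rs then [] else C' b) no_p"
        using inv lenT' unfolding dist_inv_def by simp
    qed simp
    then show ?thesis by simp
  qed
  show ?thesis unfolding distribute_bucket_def
    apply (rule wp_weaken)
      apply (rule wp_bind, rule wp_post[OF get])
      apply (elim conjE, unfold CD, hypsubst)
      apply (rule wp_bind, rule wp_post[OF wp_load_loop[OF len]])
      apply (elim conjE, hypsubst)
      apply (rule wp_bind, rule wp_post[OF wp_check_loop])
      apply (elim conjE, hypsubst)
      apply (rule wp_bind, rule wp_post[OF wp_pad_loop])
          apply assumption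
         apply blast
        apply (erule out)
       apply (rule noN)
      apply (elim conjE, hypsubst)
      apply (rule put)
       apply assumption
      apply assumption
     apply (simp_all add: len algebra_simps)
    done
qed

section \<open>Clean-up phase\<close>

abbreviation pb :: "'v item list \<Rightarrow> nat \<Rightarrow> 'v item list" where
  "pb es \<equiv> (\<lambda>_. [])(0 := es)"

lemma held_cb_pb: "8 + length cs + length es \<le> m \<Longrightarrow> held m (cb cs) (pb es)"
  by (rule held_upd_p[OF held_cb[OF order_refl]]) simp

lemma wp_undummy_loop:
  assumes "length cs = s * cap"
  shows "wp (for_loop (s * cap) (\<lambda>_. do {
       c \<leftarrow> pop_c 0;
       e \<leftarrow> decrypt dec c;
       if e = None then return () else push_p 0 e })) 0 (s * cap * 3)
    (\<lambda>_ S' C' D'. S' = S \<and> C' = no_c \<and> D' = pb (filter (\<lambda>e. e \<noteq> None) (map dec cs))) S (cb cs) no_p"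
proof -
  let ?es = "\<lambda>k. filter (\<lambda>e. e \<noteq> None) (map dec (take k cs))"
  let ?P = "\<lambda>k S' C' D'. S' = S \<and> C' = cb (drop k cs) \<and> D' = pb (?es k)"
  have "wp (for_loop (s * cap) (\<lambda>_. do {
       c \<leftarrow> pop_c 0;
       e \<leftarrow> decrypt dec c;
       if e = None then return () else push_p 0 e })) (s * cap * 0) (s * cap * 3)
    (\<lambda>_. ?P (s * cap)) S (cb cs) no_p"
  proof (rule wp_for[where P = ?P])
    fix k S' C' D'
    assume k: "k < s * cap" and P: "?P k S' C' D'"
    have d: "drop k cs = cs ! k # drop (Suc k) cs" "take (Suc k) cs = take k cs @ [cs ! k]"
      using k assms by (auto simp: Cons_nth_drop_Suc take_Suc_conv_app_nth)
    have C': "tl (C' 0) = drop (Suc k) cs" "hd (C' 0) = cs ! k" "C'(0 := drop (Suc k) cs) = cb (drop (Suc k) cs)"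
      using P d(1) by simp_all
    have push: "D'(0 := D' 0 @ [dec (cs ! k)]) = pb (?es (Suc k))" if "dec (cs ! k) \<noteq> None"
      using P d(2) that by simp
    have skip: "D' = pb (?es (Suc k))" if "dec (cs ! k) = None"
      using P d(2) that by simp
    \<comment> \<open>At most as many plaintexts are kept as ciphertexts were popped, so both
      buffers together never exceed \<open>s * cap\<close>.\<close>
    have "length (?es (Suc k)) \<le> Suc k"
      by (rule order_trans[OF length_filter_le]) simp
    then have h: "held M (cb (drop (Suc k) cs)) (pb (?es (Suc k)))"
      using k assms by (intro held_cb_pb) simp
    show "wp (do {
         c \<leftarrow> pop_c 0;
         e \<leftarrow> decrypt dec c;
         if e = None then return () else push_p 0 e }) 0 3 (\<lambda>_. ?P (Suc k)) S' C' D'"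
      apply (rule wp_weaken)
        apply (rule wp_bind, rule wp_pop_c)
        apply (rule wp_bind, rule wp_decrypt)
        apply (unfold C')
        apply (rule wp_if)
         apply (rule wp_return)
         apply (use P skip in blast)
        apply (rule wp_push_p; subst push, assumption)
         apply (rule h)
        apply (use P in blast)
       apply simp_all
      done
  qed (simp add: fun_upd_idem)
  then show ?thesis using assms by (simp add: fun_upd_idem)
qed

text \<open>The phase only reads \<open>T\<close>, so its clause covers all buckets throughout, now
  at full bucket width. Buckets of \<open>O\<close> are known up to order, which is all that the
  sort guarantees here.\<close>

definition clean_inv :: "(nat \<Rightarrow> nat) \<Rightarrow> 'v item list \<Rightarrow> nat \<Rightarrow>
    (arr \<Rightarrow> 'c list) \<Rightarrow> (nat \<Rightarrow> 'c list) \<Rightarrow> (nat \<Rightarrow> 'v item list) \<Rightarrow> bool" where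
  "clean_inv \<rho> es j S C D \<longleftrightarrow> C = no_c \<and> D = no_p \<and> length (S Arr_I) = s * s \<and>
     length (S Arr_T) = s * s * cap \<and> length (S Arr_O) = s * s \<and>
     (\<forall>j'<s. filter (\<lambda>e. e \<noteq> None) (map dec (block (s * cap) j' (S Arr_T))) =
        filter (\<lambda>e. dest s \<rho> e = j') es) \<and>
     (\<forall>j'<j. mset (map dec (block s j' (S Arr_O))) = mset (filter (\<lambda>e. dest s \<rho> e = j') es))"

text \<open>Work: \<open>1 + s * cap\<close> for the read, \<open>3 * s * cap\<close> for decryption
  and dropping dummies, 1 for the length, \<open>10 * s * L + 1\<close> for the sort,
  \<open>3 * s\<close> for encryption, \<open>1 + s\<close> for the write.\<close>

lemma wp_clean_up_bucket:
  assumes "all_keys (s * s) es" "\<rho> permutes {1..s * s}" "j < s" "clean_inv \<rho> es j S C D" "s \<le> 2 ^ L"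
  shows "wp (clean_up_bucket enc dec s cap \<rho> j) 2 (4 + 4 * s + 4 * s * cap + 10 * s * L)
    (\<lambda>_. clean_inv \<rho> es (Suc j)) S C D"
proof -
  note inv = assms(4)[unfolded clean_inv_def]
  define cs where "cs = block (s * cap) j (S Arr_T)"
  define fs where "fs = filter (\<lambda>e. dest s \<rho> e = j) es"
  have CD: "C = no_c" "D = no_p" using inv by auto
  have fits: "j * (s * cap) + s * cap \<le> s * s * cap"
    using mult_le_mono1[of "j + 1" s "s * cap"] assms(3) by simp
  have len: "length cs = s * cap" unfolding cs_def
    by (rule length_block) (use inv fits in \<open>simp add: algebra_simps\<close>)
  \<comment> \<open>Here the exact count enters: the computed length is \<open>s\<close>, which
    fixes both the cost of the sort and the size of the range written to \<open>O\<close>.\<close>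
  have fs: "filter (\<lambda>e. e \<noteq> None) (map dec cs) = fs" "length fs = s"
    using inv assms(3) length_filter_dest[OF assms(1-3)] by (auto simp: cs_def fs_def)
  have get: "wp (getRange Arr_T (j * (s * cap)) (s * cap) 0) 1 (1 + length cs)
      (\<lambda>_ S' C' D'. S' = S \<and> C' = cb cs \<and> D' = D) S C D"
    by (rule wp_getRange) (use len CD in \<open>auto simp: cs_def block_def intro!: held_cb\<close>)
  have sort: "wp (merge_sort \<rho> 0 s) 0 (10 * s * L + 1)
      (\<lambda>_ S' C' D'. S' = S \<and> C' = no_c \<and> (\<exists>gs. mset gs = mset fs \<and> D' = pb gs)) S no_c (pb fs)"
  proof (rule wp_post, rule wp_merge_sort)
    show "held (8 + s) no_c (pb fs)" using held_cb_pb[of "[]" fs "8 + s"] fs(2) by (simp add: fun_upd_idem)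
    \<comment> \<open>Only buffer 0 is nonempty, and 0 is not a descendant of itself.\<close>
    show "pb fs b = []" if "(b + 1) div 2 ^ Suc i = 0 + 1" for b i
      using that div_pow_Suc_less[of 1 1 i] by (auto split: if_splits)
  qed (use fs(2) assms(5) in auto)
  have enc: "wp (for_loop s (\<lambda>_. do { e \<leftarrow> pop_p 0; c \<leftarrow> encrypt enc e; push_c 0 c })) 0 (3 * s)
      (\<lambda>_ S' C' D'. S' = S \<and> (\<exists>cs. map dec cs = gs \<and> C' = cb cs) \<and> D' = no_p) S no_c (pb gs)"
    if "mset gs = mset fs" for gs
  proof (rule wp_post, rule wp_encrypt_loop)
    have l: "length gs = s" using mset_eq_length[OF that] fs(2) by simp
    show "held (8 + s) no_c (pb gs)" using held_cb_pb[of "[]" gs "8 + s"] l by (simp add: fun_upd_idem)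
    show "length (pb gs 0) = s" using l by simp
  qed (auto simp: fun_upd_idem fun_eq_iff)
  have put: "wp (putRange Arr_O (j * s) 0) 1 (1 + s) (\<lambda>_. clean_inv \<rho> es (Suc j)) S (cb ds) no_p"
    if ds: "map dec ds = gs" "mset gs = mset fs" for ds gs
  proof -
    have "length (map dec ds) = s" using mset_eq_length[OF ds(2)] fs(2) by (simp only: ds)
    then have l: "length ds = s" by simp
    have fit: "(j + 1) * s \<le> length (S Arr_O)"
      using inv mult_le_mono1[of "j + 1" s s] assms(3) by simp
    let ?O = "write_range (j * s) ds (S Arr_O)"
    have lO: "length ?O = s * s"
      by (subst length_write_range) (use inv fit l in auto)
    have bl: "block s j' ?O = (if j' = j then ds else block s j' (S Arr_O))" for j'
      by (rule block_write_range[OF l fit])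
    have m: "mset (map dec (block s j' ?O)) = mset (filter (\<lambda>e. dest s \<rho> e = j') es)" if "j' < Suc j" for j'
    proof (cases "j' = j")
      case True
      then show ?thesis using bl ds by (simp add: fs_def)
    next
      case False
      then show ?thesis using bl inv that by simp
    qed
    have "wp (putRange Arr_O (j * s) 0) 1 (1 + length (cb ds 0)) (\<lambda>_. clean_inv \<rho> es (Suc j)) S (cb ds) no_p"
    proof (rule wp_putRange)
      show "S(Arr_O := ?O) = S(Arr_O := write_range (j * s) (cb ds 0) (S Arr_O))" by simp
      show "stor (S(Arr_O := ?O)) \<le> s * s * cap + 2 * (s * s)"
        using inv lO by (simp add: stor_def)
      show "clean_inv \<rho> es (Suc j) (S(Arr_O := ?O)) ((cb ds)(0 := [])) no_p"
        unfolding clean_inv_def using inv lO m by (auto simp: fun_upd_idem)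
    qed (use l in simp)
    then show ?thesis using l by simp
  qed
  show ?thesis unfolding clean_up_bucket_def
    apply (rule wp_weaken)
      apply (rule wp_bind, rule wp_post[OF get])
      apply (elim conjE, unfold CD, hypsubst)
      apply (rule wp_bind, rule wp_post[OF wp_undummy_loop[OF len]])
      apply (elim conjE, unfold fs, hypsubst)
      apply (rule wp_bind, rule wp_length_p)
      apply (unfold fun_upd_same fs)
      apply (rule wp_bind, rule wp_post[OF sort])
      apply (elim conjE exE, hypsubst)
      apply (rule wp_bind, rule wp_post[OF enc], assumption)
      apply (elim conjE exE, hypsubst)
      apply (rule put, rule refl, assumption)
     apply (simp_all add: len algebra_simps)
    done
qed

lemma wp_shuffle_pass:
  assumes "all_keys (s * s) (map dec (S Arr_I))" "\<rho> permutes {1..s * s}" "s \<le> 2 ^ L"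
    and "length (S Arr_T) = s * s * cap" "length (S Arr_O) = s * s"
  shows "wp (shuffle_pass enc dec s cap \<rho>) (4 * s) (s * (5 + 12 * s + 9 * s * cap + 10 * s * L))
    (\<lambda>_ S' C' D'. C' = no_c \<and> D' = no_p \<and> length (S' Arr_I) = s * s \<and> length (S' Arr_T) = s * s * cap \<and>
       length (S' Arr_O) = s * s \<and> mset (map dec (S' Arr_O)) = mset (map dec (S Arr_I))) S no_c no_p"
proof -
  define es where "es = map dec (S Arr_I)"
  have es: "all_keys (s * s) es" using assms(1) by (simp add: es_def)
  have dist: "wp (for_loop s (distribute_bucket enc dec s cap \<rho>)) (s * 2) (s * (1 + 8 * s + 5 * s * cap))
      (\<lambda>_. dist_inv \<rho> es s) S no_c no_p"
  proof (rule wp_for[where P = "dist_inv \<rho> es"])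
    show "dist_inv \<rho> es 0 S no_c no_p" using assms by (simp add: dist_inv_def es_def)
  qed (rule wp_distribute_bucket[OF es assms(2)])
  have clean: "wp (for_loop s (clean_up_bucket enc dec s cap \<rho>)) (s * 2) (s * (4 + 4 * s + 4 * s * cap + 10 * s * L))
      (\<lambda>_. clean_inv \<rho> es s) S' C D" if inv: "dist_inv \<rho> es s S' C D" for S' C D
  proof (rule wp_for[where P = "clean_inv \<rho> es"])
    have len: "length es = s * s" using es by (simp add: all_keys_def)
    \<comment> \<open>Bucket \<open>j\<close> of \<open>T\<close> is the concatenation of its
      \<open>s\<close> batches, one from each input bucket. Filtering commutes with concatenation,
      so the batches add up to all elements destined for \<open>j\<close>.\<close>
    have "filter (\<lambda>e. e \<noteq> None) (map dec (block (s * cap) j (S' Arr_T))) = filter (\<lambda>e. dest s \<rho> e = j) es"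
      if "j < s" for j
    proof -
      have "filter (\<lambda>e. e \<noteq> None) (map dec (block (s * cap) j (S' Arr_T))) =
          concat (map (\<lambda>i. filter (\<lambda>e. e \<noteq> None) (map dec (block cap (j * s + i) (S' Arr_T)))) [0..<s])"
        by (simp add: block_concat_blocks map_concat filter_concat o_def)
      also have "\<dots> = concat (map (\<lambda>i. filter (\<lambda>e. dest s \<rho> e = j) (block s i es)) [0..<s])"
        using inv that unfolding dist_inv_def by (intro arg_cong[where f = concat] map_cong) auto
      also have "\<dots> = filter (\<lambda>e. dest s \<rho> e = j) (concat (map (\<lambda>i. block s i es) [0..<s]))"
        by (simp add: filter_concat o_def)
      finally show ?thesis by (simp only: concat_blocks[OF len])
    qed
    then show "clean_inv \<rho> es 0 S' C D"
      using inv len unfolding dist_inv_def clean_inv_def by auto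
  qed (use assms es in \<open>auto intro!: wp_clean_up_bucket\<close>)
  \<comment> \<open>The buckets of \<open>O\<close> hold the destination classes up to order, and
    these classes partition the input.\<close>
  have fin: "mset (map dec (S' Arr_O)) = mset es" if "clean_inv \<rho> es s S' C D" for S' C D
  proof -
    have "mset (map dec (S' Arr_O)) = (\<Sum>j<s. mset (block s j (map dec (S' Arr_O))))"
      by (rule mset_concat_blocks) (use that in \<open>simp add: clean_inv_def\<close>)
    also have "\<dots> = (\<Sum>j<s. mset (filter (\<lambda>e. dest s \<rho> e = j) es))"
      by (rule sum.cong) (use that in \<open>auto simp: clean_inv_def simp flip: map_block\<close>)
    also have "\<dots> = mset es" by (rule sum_mset_filter) (rule dest_less[OF es assms(2)])
    finally show ?thesis .
  qed
  show ?thesis unfolding shuffle_pass_def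
    apply (rule wp_conseq)
       apply (rule wp_bind, rule wp_post[OF dist])
       apply (erule clean)
      apply (simp_all add: algebra_simps)
    using fin unfolding clean_inv_def es_def by auto
qed

section \<open>Copying \<open>O\<close> back to \<open>I\<close>\<close>

lemma wp_rotate_loop:
  assumes "length cs = s"
  shows "wp (for_loop s (\<lambda>_. do {
       c \<leftarrow> pop_c 0;
       e \<leftarrow> decrypt dec c;
       c' \<leftarrow> encrypt enc e;
       push_c 0 c' })) 0 (s * 4)
    (\<lambda>_ S' C' D'. S' = S \<and> D' = no_p \<and> (\<exists>ds. map dec ds = map dec cs \<and> C' = cb ds)) S (cb cs) no_p"
proof -
  \<comment> \<open>The buffer is a rotating queue: each ciphertext leaves at the front and returns
    re-encrypted at the back, so after \<open>s\<close> rounds it holds the new ciphertexts in the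
    old order.\<close>
  let ?P = "\<lambda>k S' C' D'. S' = S \<and> D' = no_p \<and>
    (\<exists>ds. map dec ds = map dec (take k cs) \<and> C' = cb (drop k cs @ ds))"
  have "wp (for_loop s (\<lambda>_. do {
       c \<leftarrow> pop_c 0;
       e \<leftarrow> decrypt dec c;
       c' \<leftarrow> encrypt enc e;
       push_c 0 c' })) (s * 0) (s * 4) (\<lambda>_. ?P s) S (cb cs) no_p"
  proof (rule wp_for[where P = ?P])
    show "?P 0 S (cb cs) no_p" by simp
  next
    fix k S' C' D'
    assume k: "k < s" and "?P k S' C' D'"
    then obtain ds where P: "S' = S" "D' = no_p" "map dec ds = map dec (take k cs)" "C' = cb (drop k cs @ ds)"
      by blast
    have d: "drop k cs = cs ! k # drop (Suc k) cs" "take (Suc k) cs = take k cs @ [cs ! k]"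
      using k assms by (auto simp: Cons_nth_drop_Suc take_Suc_conv_app_nth)
    let ?x = "\<lambda>r. enc r (dec (cs ! k))"
    have C': "hd (C' 0) = cs ! k" "C'(0 := tl (C' 0)) = cb (drop (Suc k) cs @ ds)"
      "(cb (drop (Suc k) cs @ ds))(0 := cb (drop (Suc k) cs @ ds) 0 @ [?x r]) = cb (drop (Suc k) cs @ ds @ [?x r])" for r
      using P(4) d(1) by simp_all
    have m: "map dec (ds @ [?x r]) = map dec (take (Suc k) cs)" for r
      using P(3) d(2) dec_enc by simp
    then have Q: "?P (Suc k) S (cb (drop (Suc k) cs @ ds @ [?x r])) no_p" for r by blast
    have "length (ds @ [?x r]) = Suc k" for r
      using arg_cong[OF m, of length] k assms by simp
    then have h: "held M (cb (drop (Suc k) cs @ ds @ [?x r])) no_p" for r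
      using k assms by (intro held_cb) simp
    show "wp (do {
         c \<leftarrow> pop_c 0;
         e \<leftarrow> decrypt dec c;
         c' \<leftarrow> encrypt enc e;
         push_c 0 c' }) 0 4 (\<lambda>_. ?P (Suc k)) S' C' D'"
      apply (rule wp_weaken)
        apply (rule wp_bind, rule wp_pop_c)
        apply (rule wp_bind, rule wp_decrypt)
        apply (rule wp_bind, rule wp_encrypt)
        apply (rule wp_push_c)
         apply (unfold C' P(1,2))
         apply (rule h)
        apply (rule Q)
       apply simp_all
      done
  qed
  then show ?thesis using assms by simp
qed

lemma wp_assign_I_O:
  assumes "length (S Arr_I) = s * s" "length (S Arr_T) = s * s * cap" "length (S Arr_O) = s * s"
  shows "wp (assign_I_O enc dec s) (2 * s) (s * (2 + 6 * s))
    (\<lambda>_ S' C' D'. C' = no_c \<and> D' = no_p \<and> length (S' Arr_T) = s * s * cap \<and>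
       length (S' Arr_O) = s * s \<and> map dec (S' Arr_I) = map dec (S Arr_O)) S no_c no_p"
proof -
  let ?P = "\<lambda>i S' C' D'. C' = no_c \<and> D' = no_p \<and> length (S' Arr_I) = s * s \<and> S' Arr_T = S Arr_T \<and>
     S' Arr_O = S Arr_O \<and> (\<forall>i'<i. map dec (block s i' (S' Arr_I)) = map dec (block s i' (S Arr_O)))"
  let ?body = "\<lambda>i. do {
     getRange Arr_O (i * s) s 0;
     for_loop s (\<lambda>_. do {
       c \<leftarrow> pop_c 0;
       e \<leftarrow> decrypt dec c;
       c' \<leftarrow> encrypt enc e;
       push_c 0 c' });
     putRange Arr_I (i * s) 0 }"
  have "wp (for_loop s ?body) (s * 2) (s * (2 + 6 * s)) (\<lambda>_. ?P s) S no_c no_p"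
  proof (rule wp_for[where P = ?P])
    show "?P 0 S no_c no_p" using assms by simp
  next
    fix i S' C' D'
    assume i: "i < s" and P: "?P i S' C' D'"
    have CD: "C' = no_c" "D' = no_p" using P by auto
    have fit: "(i + 1) * s \<le> s * s" using i by (intro mult_le_mono1) simp
    define cs where "cs = block s i (S' Arr_O)"
    have len: "length cs = s" unfolding cs_def
      by (rule length_block) (use P assms fit in auto)
    have get: "wp (getRange Arr_O (i * s) s 0) 1 (1 + length cs)
        (\<lambda>_ S'' C'' D''. S'' = S' \<and> C'' = cb cs \<and> D'' = D') S' C' D'"
      by (rule wp_getRange) (use len CD in \<open>auto simp: cs_def block_def intro!: held_cb\<close>)
    have put: "wp (putRange Arr_I (i * s) 0) 1 (1 + s) (\<lambda>_. ?P (Suc i)) S' (cb ds) no_p"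
      if ds: "map dec ds = map dec cs" for ds
    proof -
      have l: "length ds = s" using arg_cong[OF ds, of length] len by simp
      have fit': "(i + 1) * s \<le> length (S' Arr_I)" using P fit by auto
      let ?I = "write_range (i * s) ds (S' Arr_I)"
      have lI: "length ?I = s * s"
        by (subst length_write_range) (use P fit l in auto)
      have bl: "block s i' ?I = (if i' = i then ds else block s i' (S' Arr_I))" for i'
        by (rule block_write_range[OF l fit'])
      have m: "map dec (block s i' ?I) = map dec (block s i' (S Arr_O))" if "i' < Suc i" for i'
      proof (cases "i' = i")
        case True
        then show ?thesis using bl ds P by (simp add: cs_def)
      next
        case False
        then show ?thesis using bl P that by simp
      qed
      have "wp (putRange Arr_I (i * s) 0) 1 (1 + length (cb ds 0)) (\<lambda>_. ?P (Suc i)) S' (cb ds) no_p"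
      proof (rule wp_putRange)
        show "S'(Arr_I := ?I) = S'(Arr_I := write_range (i * s) (cb ds 0) (S' Arr_I))" by simp
        show "stor (S'(Arr_I := ?I)) \<le> s * s * cap + 2 * (s * s)"
          using P assms lI by (simp add: stor_def)
        show "?P (Suc i) (S'(Arr_I := ?I)) ((cb ds)(0 := [])) no_p"
          using P lI m by (auto simp: fun_upd_idem)
      qed (use l in simp)
      then show ?thesis using l by simp
    qed
    show "wp (?body i) 2 (2 + 6 * s) (\<lambda>_. ?P (Suc i)) S' C' D'"
      apply (rule wp_weaken)
        apply (rule wp_bind, rule wp_post[OF get])
        apply (elim conjE, unfold CD, hypsubst)
        apply (rule wp_bind, rule wp_post[OF wp_rotate_loop[OF len]])
        apply (elim conjE exE, hypsubst)
        apply (erule put)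
       apply (simp_all add: len algebra_simps)
      done
  qed
  then have "wp (for_loop s ?body) (2 * s) (s * (2 + 6 * s)) (\<lambda>_. ?P s) S no_c no_p"
    by (simp add: mult.commute)
  then show ?thesis unfolding assign_I_O_def
  proof (rule wp_post)
    fix S' C' D'
    assume P: "?P s S' C' D'"
    have "map dec (S' Arr_I) = concat (map (\<lambda>i. block s i (map dec (S' Arr_I))) [0..<s])"
      by (rule concat_blocks[symmetric]) (use P in simp)
    also have "\<dots> = concat (map (\<lambda>i. block s i (map dec (S Arr_O))) [0..<s])"
      using P by (intro arg_cong[where f = concat] map_cong) (auto simp flip: map_block)
    also have "\<dots> = map dec (S Arr_O)" by (rule concat_blocks) (use assms in simp)
    finally show "C' = no_c \<and> D' = no_p \<and> length (S' Arr_T) = s * s * cap \<and>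
       length (S' Arr_O) = s * s \<and> map dec (S' Arr_I) = map dec (S Arr_O)"
      using P assms by simp
  qed
qed

text \<open>Operations: \<open>4 * s\<close> for each pass and \<open>2 * s\<close> for the copy.
  The work is 1 for drawing the permutation, \<open>s * (2 + 6 * s)\<close> for the copy and twice
  the work of a pass.\<close>

lemma wp_melbourne:
  assumes "all_keys (s * s) (map dec (S Arr_I))" "\<rho> permutes {1..s * s}" "\<pi> permutes {1..s * s}" "s \<le> 2 ^ L"
    and "length (S Arr_T) = s * s * cap" "length (S Arr_O) = s * s"
  shows "wp (do {
       tick;
       shuffle_pass enc dec s cap \<rho>;
       assign_I_O enc dec s;
       shuffle_pass enc dec s cap \<pi> }) (10 * s) (1 + 12 * s + s * s * (30 + 18 * cap + 20 * L))
    (\<lambda>_ _ _ _. True) S no_c no_p"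
proof -
  have "wp (bind_prog (assign_I_O enc dec s) (\<lambda>_. shuffle_pass enc dec s cap \<pi>)) (2 * s + 4 * s)
      (s * (2 + 6 * s) + s * (5 + 12 * s + 9 * s * cap + 10 * s * L)) (\<lambda>_ _ _ _. True) S' no_c no_p"
    if "length (S' Arr_I) = s * s" "length (S' Arr_T) = s * s * cap" "length (S' Arr_O) = s * s"
      and m: "mset (map dec (S' Arr_O)) = mset (map dec (S Arr_I))" for S'
  proof (rule wp_bind, rule wp_post[OF wp_assign_I_O[OF that(1-3)]], elim conjE)
    fix S'' C'' D''
    assume *: "C'' = no_c" "D'' = no_p" "length (S'' Arr_T) = s * s * cap" "length (S'' Arr_O) = s * s"
      "map dec (S'' Arr_I) = map dec (S' Arr_O)"
    have "all_keys (s * s) (map dec (S'' Arr_I))"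
      unfolding *(5) by (rule all_keys_mset_cong[OF m[symmetric] assms(1)])
    from wp_shuffle_pass[OF this assms(3,4) *(3,4)]
    show "wp (shuffle_pass enc dec s cap \<pi>) (4 * s) (s * (5 + 12 * s + 9 * s * cap + 10 * s * L))
      (\<lambda>_ _ _ _. True) S'' C'' D''"
      unfolding *(1,2) by (rule wp_post) simp
  qed
  note rest = this
  show ?thesis
    apply (rule wp_weaken)
      apply (rule wp_bind, rule wp_tick)
      apply (rule wp_bind, rule wp_post[OF wp_shuffle_pass[OF assms(1,2,4-6)]])
      apply (elim conjE, hypsubst)
      apply (erule (3) rest)
     apply (simp_all add: algebra_simps)
    done
qed

text \<open>A worst-case statement: it covers every outcome of positive probability, failing ones
  included.\<close>

lemma melbourne_shuffle_bounds:
  assumes "input_array dec (s * s) I" "\<pi> permutes {1..s * s}" "s \<le> 2 ^ L"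
    and "length T = s * s * cap" "length Out = s * s"
    and "(res, \<sigma>) \<in> set_pmf (melbourne_shuffle enc dec s cap \<pi> (init_state I T Out r))"
  shows "ok \<sigma> \<and> length (msgs \<sigma>) \<le> 10 * s \<and> user_work \<sigma> \<le> 1 + 12 * s + s * s * (30 + 18 * cap + 20 * L)"
proof -
  define \<sigma>\<^sub>0 :: "('v, 'c) state" where "\<sigma>\<^sub>0 = init_state I T Out r"
  \<comment> \<open>A finite nonempty set is the support of its \<open>pmf_of_set\<close>, so every
    outcome is the deterministic run for some permutation \<open>\<rho>\<close>.\<close>
  have "finite {\<rho>. \<rho> permutes {1..s\<^sup>2}}" "{\<rho>. \<rho> permutes {1..s\<^sup>2}} \<noteq> {}"
    using finite_permutations[of "{1..s\<^sup>2}"] permutes_id[of "{1..s\<^sup>2}"] by (simp, blast)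
  then obtain \<rho> where \<rho>: "\<rho> permutes {1..s * s}" and run:
      "(do {
         tick;
         shuffle_pass enc dec s cap \<rho>;
         assign_I_O enc dec s;
         shuffle_pass enc dec s cap \<pi> } :: ('v, 'c, unit) prog) \<sigma>\<^sub>0 = (res, \<sigma>)"
    using assms(6) by (auto simp: melbourne_shuffle_def \<sigma>\<^sub>0_def power2_eq_square)
  have compl: "all_keys (s * s) (map dec I)" by (rule input_array_all_keys[OF assms(1)])
  then have "length I = s * s" by (simp add: all_keys_def)
  then have init: "ok \<sigma>\<^sub>0" "server \<sigma>\<^sub>0 Arr_I = I" "server \<sigma>\<^sub>0 Arr_T = T" "server \<sigma>\<^sub>0 Arr_O = Out"
      "cbuf \<sigma>\<^sub>0 = no_c" "pbuf \<sigma>\<^sub>0 = no_p" "msgs \<sigma>\<^sub>0 = []" "user_work \<sigma>\<^sub>0 = 0"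
    using assms(4,5) by (simp_all add: \<sigma>\<^sub>0_def init_state_def observe_def ok_def memory_size_mem
      storage_size_stor stor_def held_def mem_def)
  have "wp (do {
       tick;
       shuffle_pass enc dec s cap \<rho>;
       assign_I_O enc dec s;
       shuffle_pass enc dec s cap \<pi> }) (10 * s) (1 + 12 * s + s * s * (30 + 18 * cap + 20 * L))
    (\<lambda>_ _ _ _. True) (server \<sigma>\<^sub>0) no_c no_p"
    by (rule wp_melbourne) (use assms(2-5) \<rho> compl init in auto)
  with run init show ?thesis unfolding wp_def by fastforce
qed

end

section \<open>From exact counts to asymptotic bounds\<close>

lemma bigo_ln_ceiling:
  fixes a :: real
  assumes "a \<ge> 0"
  shows "(\<lambda>n. real (nat \<lceil>a * ln (real n)\<rceil>)) \<in> O(\<lambda>n. ln (real n))"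
proof -
  have "(\<lambda>n. real (nat \<lceil>a * ln (real n)\<rceil>)) \<in> O(\<lambda>n. a * ln (real n) + 1)"
  proof (rule bigoI[of _ 1], rule eventually_mono[OF eventually_gt_at_top[of 0]])
    fix n :: nat assume "0 < n"
    then have "0 \<le> a * ln (real n)" using assms by simp
    then show "norm (real (nat \<lceil>a * ln (real n)\<rceil>)) \<le> 1 * norm (a * ln (real n) + 1)"
      using of_int_ceiling_le_add_one[of "a * ln (real n)"] by simp
  qed
  also have "(\<lambda>n. a * ln (real n) + 1) \<in> O(\<lambda>n. ln (real n))"
    by real_asymp
  finally show ?thesis .
qed

theorem theorem4p1:
  fixes p :: real
  assumes "p \<ge> exp 1"
  shows "\<exists>ops msg mem stor uwork swork :: nat \<Rightarrow> real.
    ops \<in> O(\<lambda>n. sqrt (real n)) \<and>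
    msg \<in> O(\<lambda>n. sqrt (real n) * ln (real n)) \<and>
    mem \<in> O(\<lambda>n. sqrt (real n) * ln (real n)) \<and>
    stor \<in> O(\<lambda>n. real n * ln (real n)) \<and>
    uwork \<in> O(\<lambda>n. real n * ln (real n)) \<and>
    swork \<in> O(\<lambda>n. real n * ln (real n)) \<and>
    (\<forall>(enc :: nat \<Rightarrow> 'v item \<Rightarrow> 'c) dec n s \<pi> I T Out r res \<sigma>.
       (\<forall>r e. dec (enc r e) = e) \<and>
       n \<ge> 1 \<and> n = s\<^sup>2 \<and> \<pi> permutes {1..n} \<and> input_array dec n I \<and>
       length T = n * batch_size p n \<and> length Out = n \<and>
       (res, \<sigma>) \<in> set_pmf (melbourne_shuffle enc dec s (batch_size p n) \<pi> (init_state I T Out r))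
       \<longrightarrow>
       real (length (msgs \<sigma>)) \<le> ops n \<and>
       (\<forall>m\<in>set (msgs \<sigma>). real m \<le> msg n) \<and>
       real (peak_memory \<sigma>) \<le> mem n \<and>
       real (peak_storage \<sigma>) \<le> stor n \<and>
       real (user_work \<sigma>) \<le> uwork n \<and>
       real (server_work \<sigma>) \<le> swork n)"
proof -
  define cap where "cap = (\<lambda>n. real (batch_size p n))"
  define L where "L = (\<lambda>n. real (nat \<lceil>log 2 (real n)\<rceil>))"
  \<comment> \<open>The witnesses are explicit bounds for every \<open>n \<ge> 1\<close>. At
    \<open>n = 1\<close> the logarithm vanishes, so constant multiples of the target functions would
    fail there; the additive terms are absorbed only for large \<open>n\<close>.\<close>
  define ops where "ops = (\<lambda>n. 10 * sqrt (real n))"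
  define msg where "msg = (\<lambda>n. sqrt (real n) * (1 + cap n))"
  define mem' where "mem' = (\<lambda>n. 8 + sqrt (real n) * (1 + cap n))"
  define stor' where "stor' = (\<lambda>n. real n * (cap n + 2))"
  define uwork where "uwork = (\<lambda>n. 1 + 12 * sqrt (real n) + real n * (30 + 18 * cap n + 20 * L n))"
  define swork where "swork = (\<lambda>n. ops n * msg n)"
  have [simp]: "p \<ge> 0" using assms exp_ge_zero order_trans by blast
  have const: "(\<lambda>n. c) \<in> O(\<lambda>n. ln (real n))" for c :: real by real_asymp
  have cap: "cap \<in> O(\<lambda>n. ln (real n))"
    unfolding cap_def batch_size_def by (rule bigo_ln_ceiling) simp
  have "L \<in> O(\<lambda>n. ln (real n))"
    using bigo_ln_ceiling[of "1 / ln 2"] by (simp add: L_def log_def)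
  then have work: "(\<lambda>n. 30 + 18 * cap n + 20 * L n) \<in> O(\<lambda>n. ln (real n))"
    using cap const by (intro sum_in_bigo) simp_all
  have cap_add: "(\<lambda>n. cap n + c) \<in> O(\<lambda>n. ln (real n))" "(\<lambda>n. c + cap n) \<in> O(\<lambda>n. ln (real n))" for c
    using cap const by (intro sum_in_bigo; simp)+
  have msg: "msg \<in> O(\<lambda>n. sqrt (real n) * ln (real n))"
    unfolding msg_def by (rule landau_o.big.mult_left[OF cap_add(2)])
  have "(\<lambda>n. 8) \<in> O(\<lambda>n. sqrt (real n) * ln (real n))" by real_asymp
  from sum_in_bigo(1)[OF this msg] have mem: "mem' \<in> O(\<lambda>n. sqrt (real n) * ln (real n))"
    by (simp add: mem'_def msg_def)
  have stor: "stor' \<in> O(\<lambda>n. real n * ln (real n))"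
    unfolding stor'_def by (rule landau_o.big.mult_left[OF cap_add(1)])
  have "(\<lambda>n. 1 + 12 * sqrt (real n)) \<in> O(\<lambda>n. real n * ln (real n))" by real_asymp
  from sum_in_bigo(1)[OF this landau_o.big.mult_left[OF work]]
  have uwork: "uwork \<in> O(\<lambda>n. real n * ln (real n))" by (simp add: uwork_def)
  have ops: "ops \<in> O(\<lambda>n. sqrt (real n))" unfolding ops_def by simp
  have "swork \<in> O(\<lambda>n. sqrt (real n) * (sqrt (real n) * ln (real n)))"
    unfolding swork_def by (rule landau_o.big.mult[OF ops msg])
  then have swork: "swork \<in> O(\<lambda>n. real n * ln (real n))" by (simp flip: mult.assoc)
  have "real (length (msgs \<sigma>)) \<le> ops n \<and> (\<forall>m\<in>set (msgs \<sigma>). real m \<le> msg n) \<and>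
       real (peak_memory \<sigma>) \<le> mem' n \<and> real (peak_storage \<sigma>) \<le> stor' n \<and>
       real (user_work \<sigma>) \<le> uwork n \<and> real (server_work \<sigma>) \<le> swork n"
    if dec: "\<forall>r e. dec (enc r e) = e" and n: "n \<ge> 1" "n = s\<^sup>2" and \<pi>: "\<pi> permutes {1..n}" and
      I: "input_array dec n I" and len: "length T = n * batch_size p n" "length Out = n" and
      run: "(res, \<sigma>) \<in> set_pmf (melbourne_shuffle enc dec s (batch_size p n) \<pi> (init_state I T Out r))"
    for enc :: "nat \<Rightarrow> 'v item \<Rightarrow> 'c" and dec n s \<pi> I T Out r res \<sigma>
  proof -
    interpret melbourne s "batch_size p n" enc dec by unfold_locales (use dec in blast)
    have s: "n = s * s" "sqrt (real n) = real s" using n(2) by (simp_all add: power2_eq_square)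
    \<comment> \<open>\<open>s \<le> n\<close> overestimates the depth of the sort by a factor of
      about 2, which is harmless and makes \<open>L\<close> a function of \<open>n\<close>
      alone.\<close>
    have "real s \<le> real n" using s(1) n(1) by (cases s) auto
    also have "real n = 2 powr log 2 (real n)" using n(1) by simp
    also have "\<dots> \<le> 2 powr L n" unfolding L_def by (intro powr_mono) linarith+
    also have "\<dots> = 2 ^ nat \<lceil>log 2 (real n)\<rceil>" by (simp add: L_def powr_realpow)
    finally have "s \<le> 2 ^ nat \<lceil>log 2 (real n)\<rceil>" by (simp flip: of_nat_power_le_of_nat_cancel_iff)
    with melbourne_shuffle_bounds[where L = "nat \<lceil>log 2 (real n)\<rceil>"] I \<pi> len run
    have b: "ok \<sigma>" "length (msgs \<sigma>) \<le> 10 * s"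
        "user_work \<sigma> \<le> 1 + 12 * s + s * s * (30 + 18 * batch_size p n + 20 * nat \<lceil>log 2 (real n)\<rceil>)"
      unfolding s(1)[symmetric] by blast+
    have ops_n: "real (length (msgs \<sigma>)) \<le> ops n" using b(2) s(2) by (simp add: ops_def)
    have "real (s + s * batch_size p n) = msg n"
      by (simp add: msg_def cap_def s(2) algebra_simps)
    then have msg_n: "real m \<le> msg n" if "m \<in> set (msgs \<sigma>)" for m
      using b(1) that unfolding ok_def by (metis of_nat_mono)
    have "real (server_work \<sigma>) = (\<Sum>m\<leftarrow>msgs \<sigma>. real m)"
      using b(1) by (simp add: ok_def flip: sum_list_of_nat)
    also have "\<dots> \<le> (\<Sum>m\<leftarrow>msgs \<sigma>. msg n)" by (rule sum_list_mono) (rule msg_n)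
    also have "\<dots> = real (length (msgs \<sigma>)) * msg n" by (simp add: sum_list_triv)
    also have "\<dots> \<le> swork n"
      unfolding swork_def by (rule mult_right_mono[OF ops_n]) (simp add: msg_def cap_def)
    finally have swork_n: "real (server_work \<sigma>) \<le> swork n" .
    have "peak_memory \<sigma> \<le> 8 + s + s * batch_size p n"
        "peak_storage \<sigma> \<le> s * s * batch_size p n + 2 * (s * s)"
      using b(1) by (simp_all add: ok_def)
    from this[THEN of_nat_mono, where 'a = real] b(3)[THEN of_nat_mono, where 'a = real]
    have "real (peak_memory \<sigma>) \<le> mem' n" "real (peak_storage \<sigma>) \<le> stor' n" "real (user_work \<sigma>) \<le> uwork n"
      unfolding mem'_def stor'_def uwork_def cap_def L_def s(2)
      by (simp_all add: s(1) algebra_simps)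
    with ops_n msg_n swork_n show ?thesis by blast
  qed
  note bounds = this
  show ?thesis
    by (rule exI[of _ ops], rule exI[of _ msg], rule exI[of _ mem'], rule exI[of _ stor'],
        rule exI[of _ uwork], rule exI[of _ swork], intro conjI)
       (use ops msg mem stor uwork swork bounds in blast)+
qed

end
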